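(* There exists a constant $d'>0$ such that for all integers $d_1>d_2>d'$ the following holds: with probability tending to $1$ as $n\to\infty$, the random graph $G\sim\mathcal{G}(n,d_1,d_2)$ with true partition $(\mathcal{A},\mathcal{B})$ has a unique partition, i.e. the only subsets $V\subset[2n]$ with $|V|=n$ such that the induced subgraphs $G_V$ and $G_{[2n]\setminus V}$ are both $d_1$-regular and the edges of $G$ between $V$ and $[2n]\setminus V$ form a $d_2$-regular bipartite graph are $V=\mathcal{A}$ and $V=\mathcal{B}$.
   Context: The regular stochastic block model $\mathcal{G}(n,d_1,d_2)$ is the random graph on vertex set $[2n]$ obtained as follows: choose an equipartition $(\mathcal{A},\mathcal{B})$ of $[2n]$ (so $|\mathcal{A}|=|\mathcal{B}|=n$) uniformly at random among all equipartitions; independently choose a uniformly random simple $d_1$-regular graph on $\mathcal{A}$ and a uniformly random simple $d_1$-regular graph on $\mathcal{B}$; independently, connect $\mathcal{A}$ and $\mathcal{B}$ by a uniformly random simple $d_2$-regular bipartite graph with parts $\mathcal{A}$ and $\mathcal{B}$. The graph is the union of these three graphs; $(\mathcal{A},\mathcal{B})$ is called the true partition. For $V\subset[2n]$, $G_V$ denotes the subgraph of $G$ induced on $V$. Only values of $n$ with $nd_1$ even are considered. *)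

theory Defs
  imports "HOL-Probability.Probability"
begin

text \<open>Simple graphs are represented by their edge sets: sets of 2-element vertex sets.\<close>

definition degree_in :: "nat set set \<Rightarrow> nat \<Rightarrow> nat" where
  "degree_in E v = card {e \<in> E. v \<in> e}"

definition regular_graph :: "nat set \<Rightarrow> nat \<Rightarrow> nat set set \<Rightarrow> bool" where
  "regular_graph V d E \<longleftrightarrow>
     E \<subseteq> {e. e \<subseteq> V \<and> card e = 2} \<and> (\<forall>v\<in>V. degree_in E v = d)"

definition bip_regular_graph :: "nat set \<Rightarrow> nat set \<Rightarrow> nat \<Rightarrow> nat set set \<Rightarrow> bool" where
  "bip_regular_graph A B d E \<longleftrightarrow>
     E \<subseteq> {{a, b} | a b. a \<in> A \<and> b \<in> B} \<and> (\<forall>v\<in>A \<union> B. degree_in E v = d)"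

definition induced :: "nat set set \<Rightarrow> nat set \<Rightarrow> nat set set" where
  "induced E V = {e \<in> E. e \<subseteq> V}"

definition between :: "nat set set \<Rightarrow> nat set \<Rightarrow> nat set \<Rightarrow> nat set set"
  where "between E V W = {e \<in> E. e \<inter> V \<noteq> {} \<and> e \<inter> W \<noteq> {}}"

definition vertices :: "nat \<Rightarrow> nat set" where
  "vertices n = {..<2*n}"

definition sbm :: "nat \<Rightarrow> nat \<Rightarrow> nat \<Rightarrow> (nat set \<times> nat set set) pmf" where
  "sbm n d1 d2 =
     bind_pmf (pmf_of_set {A. A \<subseteq> vertices n \<and> card A = n}) (\<lambda>A.
       let B = vertices n - A in
       bind_pmf (pmf_of_set {E. regular_graph A d1 E}) (\<lambda>E1.
       bind_pmf (pmf_of_set {E. regular_graph B d1 E}) (\<lambda>E2.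
       bind_pmf (pmf_of_set {E. bip_regular_graph A B d2 E}) (\<lambda>E3.
       return_pmf (A, E1 \<union> E2 \<union> E3)))))"

definition valid_partition :: "nat \<Rightarrow> nat \<Rightarrow> nat \<Rightarrow> nat set set \<Rightarrow> nat set \<Rightarrow> bool" where
  "valid_partition n d1 d2 E V \<longleftrightarrow>
     V \<subseteq> vertices n \<and> card V = n \<and>
     regular_graph V d1 (induced E V) \<and>
     regular_graph (vertices n - V) d1 (induced E (vertices n - V)) \<and>
     bip_regular_graph V (vertices n - V) d2 (between E V (vertices n - V))"

definition unique_partition :: "nat \<Rightarrow> nat \<Rightarrow> nat \<Rightarrow> nat set \<Rightarrow> nat set set \<Rightarrow> bool" where
  "unique_partition n d1 d2 A E \<longleftrightarrow>
     (\<forall>V. valid_partition n d1 d2 E V \<longrightarrow> V = A \<or> V = vertices n - A)"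

end

theory Submission
  imports Defs "HOL-Combinatorics.Permutations" "HOL-Real_Asymp.Real_Asymp"
begin

text \<open>
  Only the randomness of the bipartite graph is needed; the graphs inside \<open>A\<close> and \<open>B\<close> may be arbitrary.
  Let \<open>V\<close> be a further valid partition. Replacing \<open>V\<close> by its complement, \<open>Y = V \<inter> B\<close> has size
  \<open>1 \<le> k \<le> n / 2\<close>. Given the graph inside \<open>A\<close> and the set \<open>X = V \<inter> A\<close>, the degree conditions force
  the number \<open>b v\<close> of bipartite neighbours in \<open>Y\<close> of every \<open>v \<in> A\<close>. In the configuration model this has
  probability \<open>(\<Prod>v. d choose b v) / (n * d choose k * d)\<close>, and conditioning on simplicity costs a constant
  factor only. A union bound over the \<open>(n choose k)^2\<close> pairs \<open>(X, Y)\<close> finishes the proof: for \<open>k\<close> below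
  \<open>3 n / (4 d)\<close> the probability is at most \<open>(d k / n)^(k d)\<close>, and for larger \<open>k\<close> each of the \<open>n\<close> factors is
  a binomial point probability of order \<open>1 / sqrt (d k / n)\<close>, which beats the entropy once \<open>d\<close> is large.
\<close>

subsection \<open>Binomial point probabilities\<close>

text \<open>The profile forced on \<open>A\<close> involves the graph inside \<open>A\<close> and
  \<open>X\<close>, but neither \<open>Y\<close> nor the bipartite graph. So each pair
  \<open>(X, Y)\<close> gives a single profile event, whose probability can be bounded uniformly
  over all profiles. The threshold comes from \<open>x = d * k / n\<close>. The first estimate
  \<open>x ^ (k * d)\<close> is useful only for \<open>x\<close> bounded away from 1 from above. The
  second has factors whose square is about \<open>1 / (2 * x)\<close>, so it needs \<open>x\<close>
  bounded away from 1/2 from below; 3/4 lies in between. The entropy is large only for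
  \<open>k\<close> comparable to \<open>n\<close>, where \<open>x\<close> is of order
  \<open>d\<close>, and this is why a large \<open>d\<close> wins. An unknown profile prevents any
  exact evaluation of the product. Each factor is therefore replaced by a bound on all point
  probabilities of one binomial law, kept in squared form to avoid roots. The cost of simplicity is
  bounded without asymptotics: Markov's inequality leaves boundedly many collisions, and switchings
  remove them one level at a time. The constant is huge but depends on \<open>d\<close>
  only.\<close>

lemma central_binomial_square_le: "(2 * j + 1) * ((2 * j) choose j)\<^sup>2 \<le> 16 ^ j"
proof (induction j)
  case (Suc j)
  have r: "(j + 1) * ((2 * Suc j) choose (Suc j)) = 2 * (2 * j + 1) * ((2 * j) choose j)"
  proof -
    define u where "u = (Suc (Suc (2*j)) choose Suc j)"
    define v where "v = (Suc (2*j) choose Suc j)"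
    have "Suc j * u = Suc (Suc (2*j)) * (Suc (2*j) choose j)"
      unfolding u_def by (rule Suc_times_binomial)
    also have "(Suc (2*j) choose j) = v"
      unfolding v_def using binomial_symmetric[of j "Suc (2*j)"]
      by (simp add: Suc_diff_le del: binomial_Suc_Suc)
    also have "Suc (Suc (2*j)) * v = 2 * (Suc j * v)" by simp
    also have "Suc j * v = Suc (2*j) * (2*j choose j)"
      unfolding v_def by (rule Suc_times_binomial)
    finally show ?thesis by (simp add: u_def del: binomial_Suc_Suc)
  qed
  have "(j+1)^2 * ((2 * Suc j + 1) * ((2 * Suc j) choose (Suc j))\<^sup>2)
      = (2 * Suc j + 1) * ((j + 1) * ((2 * Suc j) choose (Suc j)))^2"
    by (simp only: power_mult_distrib mult_ac)
  also have "\<dots> = (4 * ((2*j+3) * (2*j+1))) * ((2*j+1) * ((2 * j) choose j)^2)"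
    unfolding r by (simp add: power2_eq_square algebra_simps)
  \<comment> \<open>Since \<open>(2 * j + 3) * (2 * j + 1) = 4 * (j + 1)^2 - 1\<close>, the weight
    \<open>2 * j + 1\<close> just survives the induction step.\<close>
  also have "\<dots> \<le> (4 * (4 * (j+1)^2)) * 16 ^ j"
    by (rule mult_le_mono[OF _ Suc.IH]) (simp add: power2_eq_square algebra_simps)
  also have "\<dots> = (j+1)^2 * 16 ^ Suc j" by simp
  finally show ?case by (simp only: mult_le_cancel1) simp
qed simp

text \<open>The fair case of the point estimate: \<open>(m choose b) / 2 ^ m\<close> is at most
  \<open>1 / sqrt (m + 1)\<close>. The weight \<open>m + 1\<close> keeps it meaningful at
  \<open>m = 0\<close>, which occurs when \<open>m\<close> is averaged over. Central coefficients
  suffice, and an odd row reduces to the next even one, whose central coefficient is twice its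
  own.\<close>

lemma binomial_square_le: "(m + 1) * (m choose b)\<^sup>2 \<le> 4 ^ m"
proof (cases "even m")
  case True
  then obtain j where m: "m = 2 * j" by (elim evenE)
  have "(m choose b) \<le> (2 * j choose j)" using binomial_maximum[of m b] m by simp
  then have "(m + 1) * (m choose b)\<^sup>2 \<le> (2 * j + 1) * (2 * j choose j)\<^sup>2"
    using m by (intro mult_mono power_mono) auto
  also have "\<dots> \<le> 16 ^ j" by (rule central_binomial_square_le)
  also have "16 ^ j = (4::nat) ^ m" unfolding m power_mult by simp
  finally show ?thesis .
next
  case False
  then obtain j where m: "m = 2 * j + 1" by (elim oddE)
  have "(2 * Suc j choose Suc j) = (m choose j) + (m choose Suc j)" using m by simp
  also have "(m choose Suc j) = (m choose j)"
    using binomial_symmetric[of j m] unfolding m by (simp add: Suc_diff_le del: binomial_Suc_Suc)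
  finally have e: "(2 * Suc j choose Suc j) = 2 * (m choose j)" by simp
  have "(m choose b) \<le> (m choose j)" using binomial_maximum[of m b] m by simp
  then have "4 * ((m + 1) * (m choose b)\<^sup>2) \<le> 4 * ((2 * Suc j + 1) * (m choose j)\<^sup>2)"
    using m by (intro mult_mono power_mono) auto
  also have "\<dots> = (2 * Suc j + 1) * (2 * Suc j choose Suc j)\<^sup>2"
    unfolding e by (simp add: power2_eq_square)
  also have "\<dots> \<le> 16 ^ Suc j" by (rule central_binomial_square_le)
  also have "(16::nat) ^ Suc j = 4 * 4 ^ m" unfolding m by (simp add: power_mult)
  finally show ?thesis by simp
qed

text \<open>This bounds the mean of \<open>1 / (M + 1)\<close> for a binomial \<open>M\<close>.
  Absorption turns the summands, times \<open>(d + 1) * p\<close>, into the probabilities of a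
  binomial law with \<open>d + 1\<close> trials, of which only the one for zero successes is
  missing.\<close>

lemma sum_binomial_over_Suc:
  fixes p :: real
  assumes "0 < p" "p \<le> 1"
  shows "(\<Sum>m\<le>d. (d choose m) * p ^ m * (1 - p) ^ (d - m) / (m + 1)) \<le> 1 / ((d + 1) * p)"
proof -
  have "(\<Sum>m\<le>d. (d choose m) * p ^ m * (1 - p) ^ (d - m) / (m + 1)) * ((d + 1) * p)
      = (\<Sum>m\<le>d. (Suc d choose Suc m) * p ^ Suc m * (1 - p) ^ (Suc d - Suc m))"
    unfolding sum_distrib_right
  proof (rule sum.cong)
    fix m assume "m \<in> {..d}"
    have "real (Suc m * (Suc d choose Suc m)) = real (Suc d * (d choose m))"
      by (simp only: Suc_times_binomial)
    then have C: "real (Suc d choose Suc m) = (d + 1) * (d choose m) / (m + 1)"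
      by (simp add: field_simps del: binomial_Suc_Suc)
    then show "(d choose m) * p ^ m * (1 - p) ^ (d - m) / (m + 1) * ((d + 1) * p) =
       (Suc d choose Suc m) * p ^ Suc m * (1 - p) ^ (Suc d - Suc m)"
      by (simp add: C mult_ac distrib_left distrib_right del: binomial_Suc_Suc)
  qed simp
  also have "\<dots> \<le> (\<Sum>m\<le>Suc d. (Suc d choose m) * p ^ m * (1 - p) ^ (Suc d - m))"
    using assms by (subst sum.atMost_Suc_shift) simp
  also have "\<dots> = (p + (1 - p)) ^ Suc d" by (rule binomial_ring[symmetric])
  finally show ?thesis using assms by (subst pos_le_divide_eq) (auto simp: add.commute)
qed

text \<open>After the choices in \<open>(d choose m) * (m choose b)\<close> are exchanged, the sum
  over \<open>m\<close> is the expansion of \<open>(p / 2 + (1 - p)) ^ (d - b)\<close>: a coin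
  outside the \<open>b\<close> successes is either seen with tails or not seen at all.\<close>

lemma binomial_pmf_split:
  fixes p :: real
  assumes "b \<le> d"
  shows "(d choose b) * (p / 2) ^ b * (1 - p / 2) ^ (d - b)
     = (\<Sum>m\<le>d. (d choose m) * p ^ m * (1 - p) ^ (d - m) * ((m choose b) / 2 ^ m))"
proof -
  have "(\<Sum>m\<le>d. (d choose m) * p ^ m * (1 - p) ^ (d - m) * ((m choose b) / 2 ^ m))
      = (\<Sum>m\<in>{b..d}. (d choose m) * p ^ m * (1 - p) ^ (d - m) * ((m choose b) / 2 ^ m))"
    by (rule sum.mono_neutral_right) auto
  also have "\<dots> = (\<Sum>i\<in>{0..d-b}. (d choose (i+b)) * p ^ (i+b) * (1 - p) ^ (d - (i+b)) * (((i+b) choose b) / 2 ^ (i+b)))"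
    using sum.shift_bounds_cl_nat_ivl[of "\<lambda>m. (d choose m) * p ^ m * (1 - p) ^ (d - m) * ((m choose b) / 2 ^ m)" 0 b "d-b"] assms
    by simp
  also have "\<dots> = (\<Sum>i\<le>d-b. ((d choose b) * (p/2)^b) * (((d-b) choose i) * (p/2)^i * (1-p)^(d-b-i)))"
  proof (rule sum.cong)
    fix i assume i: "i \<in> {..d-b}"
    have "(d choose (i+b)) * ((i+b) choose b) = (d choose b) * ((d-b) choose i)"
      using choose_mult[of b "i+b" d] i assms by auto
    then have *: "real (d choose (i+b)) * real ((i+b) choose b) = real (d choose b) * real ((d-b) choose i)"
      by (metis of_nat_mult)
    have "(d choose (i+b)) * p ^ (i+b) * (1 - p) ^ (d - (i+b)) * (((i+b) choose b) / 2 ^ (i+b))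
      = (real (d choose (i+b)) * real ((i+b) choose b)) * (p/2)^(i+b) * (1 - p) ^ (d - (i+b))"
      by (simp add: power_divide)
    also have "\<dots> = ((d choose b) * (p/2)^b) * (((d-b) choose i) * (p/2)^i * (1-p)^(d-b-i))"
      unfolding * by (simp add: power_add add.commute)
    finally show "(d choose (i+b)) * p ^ (i+b) * (1 - p) ^ (d - (i+b)) * (((i+b) choose b) / 2 ^ (i+b)) = \<dots>" .
  qed auto
  also have "\<dots> = ((d choose b) * (p/2)^b) * (p/2 + (1-p))^(d-b)"
    by (subst binomial_ring) (simp add: sum_distrib_left)
  also have "p/2 + (1-p) = 1 - p/2" by simp
  finally show ?thesis by simp
qed

text \<open>A Bernoulli variable of mean \<open>p / 2\<close> is a fair coin that is looked at with probability \<open>p\<close>;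
  conditioning on which coins are looked at reduces to the fair case.\<close>

lemma binomial_pmf_square_le:
  fixes \<beta> :: real
  assumes "0 < \<beta>" "2 * \<beta> \<le> 1"
  shows "((d choose b) * \<beta> ^ b * (1 - \<beta>) ^ (d - b))\<^sup>2 \<le> 1 / (2 * \<beta> * (d + 1))"
proof (cases "b \<le> d")
  case True
  define p where "p = 2 * \<beta>"
  define w where "w m = (d choose m) * p ^ m * (1 - p) ^ (d - m)" for m
  define g where "g m = (m choose b) / (2 ^ m :: real)" for m
  have p: "0 < p" "p \<le> 1" using assms by (auto simp: p_def)
  have w0: "w m \<ge> 0" for m using p by (auto simp: w_def)
  have w1: "(\<Sum>m\<le>d. w m) = 1" unfolding w_def by (subst binomial_ring[symmetric]) simp
  \<comment> \<open>Cauchy-Schwarz with the probability weights \<open>w m\<close> moves the square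
    inside the average. There \<open>(g m)^2\<close> is at most \<open>1 / (m + 1)\<close>, whose
    mean is already bounded.\<close>
  have "(\<Sum>m\<le>d. w m * g m)\<^sup>2 = (\<Sum>m\<le>d. sqrt (w m) * (sqrt (w m) * g m))\<^sup>2"
    using w0 by (simp add: mult.assoc[symmetric])
  also have "\<dots> \<le> (\<Sum>m\<le>d. (sqrt (w m))\<^sup>2) * (\<Sum>m\<le>d. (sqrt (w m) * g m)\<^sup>2)"
    by (rule Cauchy_Schwarz_ineq_sum)
  also have "\<dots> = (\<Sum>m\<le>d. w m * (g m)\<^sup>2)"
    using w0 w1 by (simp add: power_mult_distrib del: binomial_Suc_Suc)
  also have "\<dots> \<le> (\<Sum>m\<le>d. w m / (m + 1))"
  proof (rule sum_mono)
    fix m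
    have four: "(4::real) ^ m = (2 ^ m)\<^sup>2"
      by (simp add: power2_eq_square flip: power_mult_distrib)
    have "real ((m + 1) * (m choose b)\<^sup>2) \<le> real (4 ^ m)"
      using binomial_square_le[of m b] by (simp only: of_nat_le_iff)
    then have "(g m)\<^sup>2 \<le> 1 / (m + 1)"
      by (simp add: g_def power_divide field_simps flip: four)
    then show "w m * (g m)\<^sup>2 \<le> w m / (m + 1)"
      using mult_left_mono[OF _ w0] by fastforce
  qed
  also have "\<dots> \<le> 1 / ((d + 1) * p)"
    using sum_binomial_over_Suc[OF p, of d] by (simp add: w_def add.commute)
  finally show ?thesis
    using binomial_pmf_split[OF True, of p] unfolding p_def w_def g_def by (simp add: mult_ac add_ac)
qed (use assms in \<open>simp add: binomial_eq_0\<close>)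

text \<open>Both sides are binomial probabilities for the success rate \<open>j / N\<close>, scaled
  by \<open>N ^ N\<close> to stay in the natural numbers. Consecutive terms compare as
  \<open>Suc i * (N - j)\<close> with \<open>(N - i) * j\<close>, so they rise up to
  \<open>i = j\<close> and fall from there.\<close>

lemma binomial_mode:
  assumes "j \<le> N"
  shows "(N choose i) * j ^ i * (N - j) ^ (N - i) \<le> (N choose j) * j ^ j * (N - j) ^ (N - j)"
proof -
  define T where "T i = (N choose i) * j ^ i * (N - j) ^ (N - i)" for i
  have rat: "Suc i * T (Suc i) * (N - j) = ((N - i) * j) * T i" if "i < N" for i
  proof -
    have ab: "Suc i * (N choose Suc i) = (N - i) * (N choose i)"
      using binomial_absorb_comp[of N i] binomial_absorption[of i N] by simp
    have pw: "(N - j) * (N - j) ^ (N - Suc i) = (N - j) ^ (N - i)"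
      using that by (metis Suc_diff_Suc power_Suc)
    have "Suc i * T (Suc i) * (N - j)
        = (Suc i * (N choose Suc i)) * j ^ Suc i * ((N - j) * (N - j) ^ (N - Suc i))"
      unfolding T_def by (simp only: mult_ac)
    also have "\<dots> = ((N - i) * (N choose i)) * (j * j ^ i) * (N - j) ^ (N - i)"
      unfolding ab pw by (simp only: power_Suc)
    also have "\<dots> = ((N - i) * j) * T i"
      unfolding T_def by (simp only: mult_ac)
    finally show ?thesis .
  qed
  have up: "T i \<le> T (Suc i)" if "i < j" for i
  proof (cases "j = N")
    \<comment> \<open>For \<open>j = N\<close> the factor \<open>N - j\<close> is 0 and cannot be
      cancelled, but then the terms below the mode vanish.\<close>
    case True
    then have "(N - j) ^ (N - i) = 0" using that by simp
    then have "T i = 0" by (simp only: T_def mult_0_right)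
    then show ?thesis by simp
  next
    case False
    have "Suc i * (N - j) \<le> (N - i) * j"
      using that assms by (intro mult_mono[of "Suc i" j "N - j" "N - i", THEN order_trans]) auto
    then have "(Suc i * (N - j)) * T i \<le> ((N - i) * j) * T i" by (rule mult_le_mono1)
    also have "\<dots> = (Suc i * (N - j)) * T (Suc i)"
      using rat[of i] that assms by (simp only: mult_ac)
    finally have "(Suc i * (N - j)) * T i \<le> (Suc i * (N - j)) * T (Suc i)" .
    then show ?thesis using False assms by simp
  qed
  have down: "T (Suc i) \<le> T i" if "j \<le> i" for i
  proof (cases "i < N")
    case False
    then show ?thesis by (simp add: T_def binomial_eq_0)
  next
    case True
    have le: "(N - i) * j \<le> Suc i * (N - j)"
      using that True by (subst mult.commute) (intro mult_mono, auto)
    have "(Suc i * (N - j)) * T (Suc i) = ((N - i) * j) * T i"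
      using rat[OF True] by (simp only: mult_ac)
    also have "\<dots> \<le> (Suc i * (N - j)) * T i" using le by (rule mult_le_mono1)
    finally have "(Suc i * (N - j)) * T (Suc i) \<le> (Suc i * (N - j)) * T i" .
    then show ?thesis using that True by simp
  qed
  have "T i \<le> T j"
  proof (cases "i \<le> j")
    case True
    then show ?thesis
    proof (induction rule: inc_induct)
      case (step n) then show ?case using up[of n] by simp
    qed simp
  next
    case False
    then have "j \<le> i" by simp
    then show ?thesis
    proof (induction rule: dec_induct)
      case (step n) then show ?case using down[of n] by simp
    qed simp
  qed
  then show ?thesis by (simp add: T_def)
qed

text \<open>Of \<open>N + 1\<close> probabilities with sum 1, the largest is at least
  \<open>1 / (N + 1)\<close>. This polynomial loss is the price for trading a binomial coefficient
  in a denominator for a product of powers.\<close>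

lemma binomial_mode_ge:
  fixes \<beta> :: real
  assumes "j \<le> N" "N > 0" "\<beta> = j / N"
  shows "1 \<le> (N + 1) * ((N choose j) * \<beta> ^ j * (1 - \<beta>) ^ (N - j))"
proof -
  have b: "1 - \<beta> = (N - j) / N" using assms by (simp add: field_simps of_nat_diff)
  have e: "(N choose i) * \<beta> ^ i * (1 - \<beta>) ^ (N - i)
       = real ((N choose i) * j ^ i * (N - j) ^ (N - i)) / N ^ N" if "i \<le> N" for i
  proof -
    have "real N ^ N = N ^ i * N ^ (N - i)" using that by (simp flip: power_add)
    then show ?thesis unfolding b unfolding assms(3) by (simp add: power_divide)
  qed
  have "1 = (\<Sum>i\<le>N. (N choose i) * \<beta> ^ i * (1 - \<beta>) ^ (N - i))"
    by (subst binomial_ring[symmetric]) simp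
  also have "\<dots> \<le> (\<Sum>i\<le>N. (N choose j) * \<beta> ^ j * (1 - \<beta>) ^ (N - j))"
    using binomial_mode[OF assms(1)] assms(1)
    by (intro sum_mono) (simp only: e atMost_iff divide_right_mono of_nat_le_iff of_nat_0_le_iff)
  finally show ?thesis by (simp add: add.commute)
qed

subsection \<open>The union bound\<close>

text \<open>A single term of the binomial expansion. The parameter \<open>t\<close> is used at two
  values: \<open>k / n\<close> leads to \<open>(3 * n / k) ^ k\<close>, and \<open>1 / 100\<close>
  suits \<open>k\<close> below \<open>n / 100\<close>.\<close>

lemma binomial_times_power_le:
  fixes t :: real
  assumes "t \<ge> 0" "k \<le> n"
  shows "(n choose k) * t ^ k \<le> (1 + t) ^ n"
proof -
  have "(n choose k) * t ^ k \<le> (\<Sum>i\<le>n. (n choose i) * t ^ i)"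
    using assms by (intro member_le_sum[of k _ "\<lambda>i. (n choose i) * t ^ i"]) auto
  also have "\<dots> = (1 + t) ^ n" by (subst add.commute, subst binomial_ring) simp
  finally show ?thesis .
qed

lemma binomial_le_power: "(d choose b) \<le> d ^ b"
proof (cases "b \<le> d")
  case True
  then show ?thesis by (rule binomial_le_pow)
qed (simp add: binomial_eq_0)

lemma binomial_le_3n_over_k:
  assumes "1 \<le> k" "k \<le> n"
  shows "(n choose k) \<le> (3 * n / k) ^ k"
proof -
  have "(n choose k) * (k / n) ^ k \<le> (1 + real k / n) ^ n"
    using assms by (intro binomial_times_power_le) auto
  also have "\<dots> \<le> exp (real k / n) ^ n"
    by (intro power_mono exp_ge_add_one_self_aux) (use assms in auto)
  also have "\<dots> = exp 1 ^ k"
    using assms by (simp flip: exp_of_nat_mult)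
  also have "\<dots> \<le> 3 ^ k"
    by (intro power_mono) (use exp_le in auto)
  finally show ?thesis
    using assms by (simp add: power_divide power_mult_distrib field_simps)
qed

text \<open>For small \<open>k\<close> the crude bounds \<open>d choose b \<le> d ^ b\<close> and
  \<open>N choose j \<ge> (N / j) ^ j\<close> lose little enough, and the profile enters the result
  only through its sum \<open>k * d\<close>.\<close>

lemma profile_ratio_small:
  fixes b :: "'a \<Rightarrow> nat" and d k n :: nat
  assumes "finite A" "card A = n" "(\<Sum>v\<in>A. b v) = k * d" "1 \<le> k" "k \<le> n" "1 \<le> d"
  shows "(\<Prod>v\<in>A. d choose b v) / ((n * d) choose (k * d)) \<le> (d * k / n) ^ (k * d)"
proof -
  have "(\<Prod>v\<in>A. d choose b v) \<le> (\<Prod>v\<in>A. d ^ b v)"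
    by (intro prod_mono) (auto simp: binomial_le_power)
  also have "\<dots> = d ^ (k * d)"
    using assms by (simp flip: power_sum)
  finally have 1: "real (\<Prod>v\<in>A. d choose b v) \<le> d ^ (k * d)" by (simp only: of_nat_le_iff)
  have "(real (n * d) / real (k * d)) ^ (k * d) \<le> real ((n * d) choose (k * d))"
    using assms by (intro binomial_ge_n_over_k_pow_k) auto
  then have 2: "(n / k) ^ (k * d) \<le> real ((n * d) choose (k * d))" using assms by simp
  have "(\<Prod>v\<in>A. d choose b v) / ((n * d) choose (k * d)) \<le> d ^ (k * d) / (n / k) ^ (k * d)"
    by (intro frac_le 1 2) (use assms in auto)
  also have "\<dots> = (d * k / n) ^ (k * d)"
    by (simp flip: power_divide)
  finally show ?thesis .
qed

text \<open>Numerator and denominator are multiplied by \<open>M\<close>, a product of powers of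
  \<open>\<beta> = k / n\<close> and \<open>1 - \<beta>\<close>. As the profile sums to
  \<open>k * d\<close>, this \<open>M\<close> splits over the vertices and the numerator becomes a
  product of binomial point probabilities with mean parameter \<open>\<beta>\<close>. The
  denominator becomes a modal probability, which costs a factor of at most
  \<open>n * d + 1\<close>.\<close>

lemma profile_ratio_large:
  fixes b :: "'a \<Rightarrow> nat" and d k n :: nat
  assumes "finite A" "card A = n" "(\<Sum>v\<in>A. b v) = k * d" "1 \<le> k" "2 * k \<le> n" "1 \<le> d"
  shows "((\<Prod>v\<in>A. d choose b v) / ((n * d) choose (k * d)))\<^sup>2
           \<le> (n * d + 1)\<^sup>2 * (n / (2 * k * (d + 1))) ^ n"
proof (cases "\<forall>v\<in>A. b v \<le> d")
  case False
  then obtain v where "v \<in> A" "(d choose b v) = 0" by (auto simp: binomial_eq_0)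
  then have "(\<Prod>v\<in>A. d choose b v) = 0" using assms(1) by auto
  then show ?thesis by simp
next
  case True
  define \<beta> where "\<beta> = real k / n"
  have n: "n > 0" using assms by simp
  have \<beta>: "0 < \<beta>" "2 * \<beta> \<le> 1" using assms by (auto simp: \<beta>_def field_simps)
  have \<beta>': "\<beta> = real (k * d) / real (n * d)" using assms by (simp add: \<beta>_def)
  define M where "M = \<beta> ^ (k * d) * (1 - \<beta>) ^ (n * d - k * d)"
  have M: "M > 0" using \<beta> by (simp add: M_def)
  have one: "1 \<le> (n * d + 1) * (((n * d) choose (k * d)) * M)"
    using binomial_mode_ge[OF _ _ \<beta>'] assms n by (simp add: M_def mult.assoc add.commute)
  have "(\<Sum>v\<in>A. d - b v) = n * d - k * d"
    using True assms by (subst sum_subtractf_nat) auto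
  then have P: "(\<Prod>v\<in>A. d choose b v) * M
      = (\<Prod>v\<in>A. (d choose b v) * \<beta> ^ b v * (1 - \<beta>) ^ (d - b v))"
    using assms(3) by (simp add: M_def prod.distrib flip: power_sum)
  have "((\<Prod>v\<in>A. d choose b v) * M)\<^sup>2 \<le> (\<Prod>v\<in>A. 1 / (2 * \<beta> * (d + 1)))"
    unfolding P prod_power_distrib
    using binomial_pmf_square_le[OF \<beta>, of d] by (intro prod_mono) (auto simp: add.commute)
  also have "\<dots> = (n / (2 * k * (d + 1))) ^ n"
  proof -
    have "1 / (2 * \<beta> * (d + 1)) = n / (2 * k * (d + 1))"
      unfolding \<beta>_def by (simp add: field_simps)
    then show ?thesis using assms(2) by (simp only: prod_constant)
  qed
  finally have sq: "((\<Prod>v\<in>A. d choose b v) * M)\<^sup>2 \<le> (n / (2 * k * (d + 1))) ^ n" .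
  have "real (\<Prod>v\<in>A. d choose b v) / ((n * d) choose (k * d))
      \<le> (n * d + 1) * ((\<Prod>v\<in>A. d choose b v) * M)"
  proof -
    have "real (\<Prod>v\<in>A. d choose b v) * 1
      \<le> real (\<Prod>v\<in>A. d choose b v) * ((n * d + 1) * (((n * d) choose (k * d)) * M))"
      using one by (intro mult_left_mono) (auto intro: prod_nonneg)
    moreover have "((n * d) choose (k * d)) > 0" using assms by simp
    ultimately show ?thesis by (simp add: field_simps)
  qed
  then have "(real (\<Prod>v\<in>A. d choose b v) / ((n * d) choose (k * d)))\<^sup>2
      \<le> ((n * d + 1) * ((\<Prod>v\<in>A. d choose b v) * M))\<^sup>2"
    by (intro power_mono) (auto intro!: prod_nonneg divide_nonneg_nonneg)
  also have "\<dots> \<le> (n * d + 1)\<^sup>2 * (n / (2 * k * (d + 1))) ^ n"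
    using sq by (simp only: power_mult_distrib of_nat_power) (rule mult_left_mono, auto)
  finally show ?thesis by simp
qed

text \<open>This is \<open>9 * d^2 * (3 / 4) ^ (d - 3) \<le> 1 / 2\<close>, the decay needed for
  small \<open>k\<close>. From 60 on, passing from \<open>d\<close> to \<open>d + 1\<close>
  multiplies the left side by less than \<open>4 / 3\<close>.\<close>

lemma square_le_four_thirds_power: "(d::nat) \<ge> 60 \<Longrightarrow> 18 * (real d)\<^sup>2 \<le> (4 / 3) ^ (d - 3)"
proof (induction rule: dec_induct)
  case (step m)
  have "18 * (real (Suc m))\<^sup>2 \<le> (4 / 3) * (18 * (real m)\<^sup>2)"
  proof -
    have "60 \<le> real m" using step by simp
    moreover from this have "60 * real m \<le> real m * real m" by (intro mult_right_mono) auto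
    ultimately have "18 + real m * 36 \<le> 6 * (real m * real m)" by linarith
    then show ?thesis by (simp add: power2_eq_square algebra_simps)
  qed
  also have "\<dots> \<le> (4 / 3) * (4 / 3) ^ (m - 3)" using step by simp
  also have "\<dots> = (4 / 3) ^ (Suc m - 3)" proof -
    have "Suc m - 3 = Suc (m - 3)" using step by simp
    then show ?thesis by (simp only: power_Suc)
  qed
  finally show ?case .
qed (simp add: power_divide)

lemma union_term_small:
  fixes r :: real and d k n :: nat
  assumes "d \<ge> 60" "1 \<le> k" "4 * d * k \<le> 3 * n"
    and r: "0 \<le> r" "r \<le> (d * k / n) ^ (k * d)"
  shows "(real (n choose k))\<^sup>2 * r \<le> d / n * (k / 2 ^ k)"
proof -
  define x where "x = real (d * k) / n"
  have "k * 60 \<le> k * d" using assms by (intro mult_le_mono) auto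
  moreover have "4 * (k * d) \<le> 3 * n" using assms(3) by (simp add: mult_ac)
  ultimately have "k < n" using assms(2) by linarith
  then have n: "n > 0" "k \<le> n" by auto
  have x: "0 < x" "x \<le> 3 / 4"
    using assms n of_nat_mono[OF assms(3), where 'a=real] by (auto simp: x_def field_simps)
  \<comment> \<open>Per unit of \<open>k\<close>, choosing \<open>X\<close> and \<open>Y\<close>
    costs \<open>(3 * n / k)^2 = 9 * d^2 / x^2\<close>. Two of the \<open>d\<close> factors
    \<open>x\<close> cancel the denominator, \<open>d - 3\<close> of them beat
    \<open>9 * d^2\<close>, and one is kept: it yields the factor \<open>1 / n\<close> even for
    \<open>k = 1\<close>.\<close>
  have key: "(3 * real n / k)\<^sup>2 * x ^ d \<le> x / 2"
  proof -
    have e: "x ^ d = x\<^sup>2 * (x * x ^ (d - 3))"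
    proof -
      have "d = 2 + Suc (d - 3)" using assms(1) by simp
      then show ?thesis by (metis power_Suc power_add)
    qed
    have "(3 * real n / k)\<^sup>2 * x ^ d = 9 * (real d)\<^sup>2 * (x * x ^ (d - 3))"
      unfolding e using assms n by (simp add: x_def power2_eq_square field_simps)
    also have "\<dots> \<le> 9 * (real d)\<^sup>2 * (x * (3 / 4) ^ (d - 3))"
      using x by (intro mult_left_mono power_mono) auto
    also have "\<dots> = x / 2 * ((18 * (real d)\<^sup>2) * (3 / 4) ^ (d - 3))" by simp
    also have "\<dots> \<le> x / 2 * ((4 / 3) ^ (d - 3) * (3 / 4) ^ (d - 3))"
      using square_le_four_thirds_power[OF assms(1)] x by (intro mult_left_mono mult_right_mono) auto
    also have "\<dots> = x / 2" by (simp flip: power_mult_distrib)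
    finally show ?thesis .
  qed
  have "(real (n choose k))\<^sup>2 * r \<le> ((3 * real n / k) ^ k)\<^sup>2 * x ^ (k * d)"
    using r binomial_le_3n_over_k[OF assms(2) n(2)] unfolding x_def
    by (intro mult_mono power_mono) auto
  also have "\<dots> = ((3 * real n / k)\<^sup>2 * x ^ d) ^ k"
    by (simp add: power_mult_distrib flip: power_mult) (simp add: mult.commute)
  also have "\<dots> \<le> (x / 2) ^ k" using key x by (intro power_mono) auto
  also have "\<dots> = x ^ k / 2 ^ k" by (rule power_divide)
  also have "\<dots> \<le> x / 2 ^ k"
    using x assms power_decreasing[of 1 k x] by (intro divide_right_mono) auto
  also have "\<dots> = d / n * (k / 2 ^ k)" by (simp add: x_def)
  finally show ?thesis .
qed

lemma union_term_large:
  fixes r :: real and d k n :: nat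
  assumes "d \<ge> 1000" "1 \<le> k" "2 * k \<le> n" "3 * n \<le> 4 * d * k"
    and r: "r\<^sup>2 \<le> (n * d + 1)\<^sup>2 * (n / (2 * k * (d + 1))) ^ n"
  shows "(real (n choose k))\<^sup>2 * r \<le> (n * d + 1) * (49 / 50) ^ n"
proof -
  define q where "q = n / (2 * real k * (real d + 1))"
  have q0: "q \<ge> 0" by (simp add: q_def)
  have r': "r\<^sup>2 \<le> (n * d + 1)\<^sup>2 * q ^ n" using r by (simp only: q_def of_nat_mult of_nat_add of_nat_numeral of_nat_1)
  \<comment> \<open>Since \<open>r\<close> is bounded through its square, the fourth power of
    \<open>n choose k\<close> has to be beaten. For \<open>q \<le> 1 / 17\<close> the trivial bound
    \<open>2 ^ n\<close> is enough, because \<open>16 / 17 < (49 / 50)^2\<close>. Otherwise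
    \<open>k\<close> is small against \<open>n\<close>, so the entropy is small and
    \<open>q \<le> 2 / 3\<close> wins.\<close>
  have main: "((real (n choose k))\<^sup>2)\<^sup>2 * q ^ n \<le> (((49 / 50) ^ n)\<^sup>2 :: real)"
  proof (cases "17 * real n \<le> 2 * k * (d + 1)")
    case True
    then have "q \<le> 1 / 17" using assms by (simp add: q_def field_simps)
    have "(n choose k) \<le> 2 ^ n" by (rule binomial_le_pow2)
    then have "real (n choose k) \<le> 2 ^ n" by (metis of_nat_le_iff of_nat_numeral of_nat_power)
    then have "((real (n choose k))\<^sup>2)\<^sup>2 * q ^ n \<le> ((2 ^ n)\<^sup>2)\<^sup>2 * (1 / 17) ^ n"
      using \<open>q \<le> 1/17\<close> q0 by (intro mult_mono power_mono) auto
    also have "\<dots> = (16 / 17) ^ n"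
      by (simp flip: power_mult power_mult_distrib)
        (simp add: power_mult mult.commute[of n] power_divide flip: power_mult_distrib)
    also have "\<dots> \<le> ((49 / 50)\<^sup>2) ^ n" by (intro power_mono) (auto simp: power2_eq_square)
    also have "\<dots> = ((49 / 50) ^ n)\<^sup>2" by (simp flip: power_mult add: mult.commute)
    finally show ?thesis .
  next
    case False
    \<comment> \<open>Here \<open>d \<ge> 1000\<close> is decisive: failure of the first case means
      \<open>2 * k * (d + 1) < 17 * n\<close>, which forces \<open>k\<close> below
      \<open>n / 100\<close>.\<close>
    have "real (100 * k) * 17 \<le> real n * 17"
    proof -
      have "2 * real k * 1000 \<le> 2 * real k * (real d + 1)"
        using assms by (intro mult_left_mono) auto
      also have "\<dots> \<le> 17 * real n" using False by (simp add: algebra_simps)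
      finally show ?thesis by simp
    qed
    then have k: "100 * k \<le> n" by linarith
    have q: "q \<le> 2 / 3"
    proof -
      have "3 * real n \<le> 4 * (real d * real k)"
        using of_nat_mono[OF assms(4), where 'a=real] by simp
      then show ?thesis using assms by (simp add: q_def field_simps)
    qed
    have C: "real (n choose k) \<le> (101 / 100) ^ n * 100 ^ k"
      using binomial_times_power_le[of "1/100" k n] assms by (simp add: power_divide field_simps)
    \<comment> \<open>As \<open>(13 / 10) ^ 9\<close> exceeds 10 and \<open>72 * k \<le> n\<close>,
      this power is at most \<open>(13 / 10) ^ n\<close>. The total base
      \<open>(101 / 100) ^ 4 * (13 / 10) * (2 / 3)\<close> is then about 0.9.\<close>
    have "(100 ^ k) ^ 4 = ((10 ^ 8) ^ k :: real)"
      by (simp add: power_mult[symmetric] mult.commute[of k] power_mult[of _ 4 k])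
    also have "\<dots> \<le> (((13 / 10) ^ 9) ^ 8) ^ k"
      by (intro power_mono) (auto simp: power_divide)
    also have "\<dots> = (13 / 10) ^ (72 * k)" by (simp flip: power_mult)
    also have "\<dots> \<le> (13 / 10) ^ n" using k by (intro power_increasing) auto
    finally have h: "(100 ^ k) ^ 4 \<le> (13 / 10 :: real) ^ n" .
    have "((real (n choose k))\<^sup>2)\<^sup>2 * q ^ n \<le> (((101 / 100) ^ n * 100 ^ k)\<^sup>2)\<^sup>2 * (2 / 3) ^ n"
      using q q0 C by (intro mult_mono power_mono) auto
    also have "\<dots> = ((101 / 100) ^ 4) ^ n * (100 ^ k) ^ 4 * (2 / 3) ^ n"
      by (simp only: power_mult_distrib power_mult[symmetric] mult.commute) (simp add: mult.commute)
    also have "\<dots> \<le> ((101 / 100) ^ 4) ^ n * (13 / 10) ^ n * (2 / 3) ^ n"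
      using h by (intro mult_mono) auto
    also have "\<dots> = ((101 / 100) ^ 4 * (13 / 10) * (2 / 3)) ^ n"
      by (simp only: power_mult_distrib)
    also have "\<dots> \<le> ((49 / 50)\<^sup>2) ^ n"
      by (intro power_mono) (auto simp: power_divide)
    also have "\<dots> = ((49 / 50) ^ n)\<^sup>2" by (simp flip: power_mult add: mult.commute)
    finally show ?thesis .
  qed
  have "((real (n choose k))\<^sup>2 * r)\<^sup>2 = ((real (n choose k))\<^sup>2)\<^sup>2 * r\<^sup>2"
    by (rule power_mult_distrib)
  also have "\<dots> \<le> ((real (n choose k))\<^sup>2)\<^sup>2 * ((n * d + 1)\<^sup>2 * q ^ n)"
    using r' by (intro mult_left_mono) auto
  also have "\<dots> = (n * d + 1)\<^sup>2 * (((real (n choose k))\<^sup>2)\<^sup>2 * q ^ n)" by simp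
  also have "\<dots> \<le> (n * d + 1)\<^sup>2 * ((49 / 50) ^ n)\<^sup>2"
    using main by (intro mult_left_mono) auto
  also have "\<dots> = ((n * d + 1) * (49 / 50) ^ n)\<^sup>2" by (simp add: power_mult_distrib)
  finally show ?thesis by (rule power2_le_imp_le) auto
qed

text \<open>Adding the bounds of the two regimes covers every \<open>k\<close> by one expression, so
  the summation needs no case distinction. The second summand is free of \<open>k\<close>; repeating
  it costs at most a factor \<open>n\<close> against exponential decay.\<close>

definition union_term :: "nat \<Rightarrow> nat \<Rightarrow> nat \<Rightarrow> real" where
  "union_term d n k = d / n * (k / 2 ^ k) + (n * d + 1) * (49 / 50) ^ n"

lemma union_term_ge:
  fixes r :: real and d k n :: nat
  assumes "d \<ge> 1000" "1 \<le> k" "2 * k \<le> n"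
    and "0 \<le> r" "r \<le> (d * k / n) ^ (k * d)"
    and "r\<^sup>2 \<le> (n * d + 1)\<^sup>2 * (n / (2 * k * (d + 1))) ^ n"
  shows "(real (n choose k))\<^sup>2 * r \<le> union_term d n k"
proof -
  have "0 \<le> d / n * (k / 2 ^ k)" "0 \<le> (n * d + 1) * ((49 / 50) ^ n :: real)" by auto
  moreover have "(real (n choose k))\<^sup>2 * r \<le> d / n * (k / 2 ^ k) \<or>
    (real (n choose k))\<^sup>2 * r \<le> (n * d + 1) * (49 / 50) ^ n"
    using union_term_small[of d k n r] union_term_large[of d k n r] assms
    by (cases "4 * d * k \<le> 3 * n") auto
  moreover have "union_term d n k = d / n * (k / 2 ^ k) + real (n * d + 1) * (49 / 50) ^ n"
    by (simp add: union_term_def add.commute)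
  ultimately show ?thesis by linarith
qed

definition union_bound :: "nat \<Rightarrow> nat \<Rightarrow> real" where
  "union_bound d n = 2 * d / n + n * ((n * d + 1) * (49 / 50) ^ n)"

lemma union_bound_tendsto_0: "union_bound d \<longlonglongrightarrow> 0"
proof -
  have "(\<lambda>n. 2 * c / real n + n * ((n * c + 1) * (49 / 50) ^ n)) \<longlonglongrightarrow> 0" for c :: real
    by real_asymp
  from this[of "real d"] show ?thesis by (simp add: union_bound_def[abs_def])
qed

lemma sum_k_over_power_two: "(\<Sum>k\<in>{1..m}. real k / 2 ^ k) \<le> 2"
proof -
  have "(\<Sum>k\<in>{1..m}. real k / 2 ^ k) = 2 - (m + 2) / 2 ^ m"
    by (induction m) (auto simp: field_simps)
  then show ?thesis by simp
qed

lemma sum_union_term_le: "(\<Sum>k\<in>{1..n div 2}. union_term d n k) \<le> union_bound d n"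
proof -
  have "(\<Sum>k\<in>{1..n div 2}. union_term d n k)
      = d / n * (\<Sum>k\<in>{1..n div 2}. k / 2 ^ k) + (n div 2) * ((n * d + 1) * (49 / 50) ^ n)"
    by (simp add: union_term_def sum.distrib sum_distrib_left)
  also have "\<dots> \<le> d / n * 2 + n * ((n * d + 1) * (49 / 50) ^ n)"
    using sum_k_over_power_two by (intro add_mono mult_left_mono mult_right_mono) auto
  finally show ?thesis by (simp add: union_bound_def mult.commute add.commute)
qed

subsection \<open>The configuration model\<close>

text \<open>With \<open>P = A \<times> {..<d}\<close> an assignment is a configuration in which only the left vertices are split
  into \<open>d\<close> points. A simple bipartite \<open>d\<close>-regular graph on \<open>n + n\<close> vertices comes from exactly
  \<open>(d!)^n\<close> assignments, so uniform assignments conditioned on being simple give the uniform graph.\<close>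

definition assignments :: "'p set \<Rightarrow> 'b set \<Rightarrow> nat \<Rightarrow> ('p \<Rightarrow> 'b) set" where
  "assignments P B d = {f \<in> P \<rightarrow>\<^sub>E B. \<forall>w\<in>B. card {p \<in> P. f p = w} = d}"

lemma finite_assignments [simp]: "finite P \<Longrightarrow> finite B \<Longrightarrow> finite (assignments P B d)"
  unfolding assignments_def by (intro finite_subset[OF _ finite_PiE[of P "\<lambda>_. B"]]) auto

section \<open>Symmetry of assignments under permutations of the points\<close>

lemma card_permute:
  assumes "\<pi> permutes P"
  shows "card {p \<in> P. Q (\<pi> p)} = card {p \<in> P. Q p}"
proof (rule bij_betw_same_card)
  show "bij_betw \<pi> {p \<in> P. Q (\<pi> p)} {p \<in> P. Q p}"
    by (rule bij_betw_byWitness[where f' = "inv \<pi>"])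
      (use assms in \<open>auto simp: permutes_inverses permutes_in_image permutes_inv\<close>)
qed

lemma assignments_permute:
  assumes "f \<in> assignments P B d" "\<pi> permutes P"
  shows "f \<circ> \<pi> \<in> assignments P B d"
proof -
  have "f \<circ> \<pi> \<in> P \<rightarrow>\<^sub>E B"
  proof (rule PiE_I)
    fix p assume "p \<in> P"
    then show "(f \<circ> \<pi>) p \<in> B"
      using assms permutes_in_image[OF assms(2)] by (auto simp: assignments_def)
  next
    fix p assume "p \<notin> P"
    then show "(f \<circ> \<pi>) p = undefined"
      using assms permutes_not_in[OF assms(2)] by (auto simp: assignments_def)
  qed
  then show ?thesis
    using assms(1) card_permute[OF assms(2), of "\<lambda>p. f p = w" for w] by (auto simp: assignments_def)
qed

lemma inj_on_comp_permutes: "\<pi> permutes P \<Longrightarrow> inj_on (\<lambda>f. f \<circ> \<pi>) F"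
proof (rule inj_onI)
  fix f g assume "\<pi> permutes P" "f \<circ> \<pi> = g \<circ> \<pi>"
  then have "f \<circ> (\<pi> \<circ> inv \<pi>) = g \<circ> (\<pi> \<circ> inv \<pi>)" by (simp only: comp_assoc[symmetric])
  with \<open>\<pi> permutes P\<close> show "f = g" by (simp only: permutes_inv_o comp_id)
qed

lemma ex_permutes_image:
  assumes "finite P" "S \<subseteq> P" "S' \<subseteq> P" "card S = card S'"
  shows "\<exists>\<pi>. \<pi> permutes P \<and> \<pi> ` S = S'"
proof -
  have fin: "finite S" "finite S'" using assms finite_subset by auto
  have "card (P - S) = card (P - S')" using assms fin by (simp add: card_Diff_subset)
  then obtain g where g: "bij_betw g (P - S) (P - S')"
    using assms(1) by (metis finite_Diff finite_same_card_bij)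
  obtain h where h: "bij_betw h S S'"
    using assms fin by (metis finite_same_card_bij)
  define \<pi> where "\<pi> x = (if x \<in> S then h x else if x \<in> P then g x else x)" for x
  have S: "bij_betw \<pi> S S'" using h by (rule bij_betw_cong[THEN iffD1, rotated]) (simp add: \<pi>_def)
  have "bij_betw \<pi> (P - S) (P - S')"
    using g by (rule bij_betw_cong[THEN iffD1, rotated]) (simp add: \<pi>_def)
  with S have "bij_betw \<pi> (S \<union> (P - S)) (S' \<union> (P - S'))"
    by (rule bij_betw_combine) auto
  then have "bij_betw \<pi> P P" using assms by (simp add: Un_absorb1)
  then have "\<pi> permutes P"
    by (rule bij_imp_permutes) (use assms in \<open>auto simp: \<pi>_def\<close>)
  with S show ?thesis by (auto simp: bij_betw_def)
qed

text \<open>Precomposition with a permutation of \<open>P\<close> that carries \<open>S'\<close>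
  onto \<open>S\<close> is an injection between the two classes. The roles of \<open>S\<close> and
  \<open>S'\<close> can be exchanged, so equality follows.\<close>

lemma card_assignments_preimage_le:
  assumes "finite P" "finite B" "S \<subseteq> P" "S' \<subseteq> P" "card S = card S'"
  shows "card {f \<in> assignments P B d. {p \<in> P. f p \<in> Y} = S}
       \<le> card {f \<in> assignments P B d. {p \<in> P. f p \<in> Y} = S'}"
proof -
  obtain \<pi> where \<pi>: "\<pi> permutes P" "\<pi> ` S' = S"
    using ex_permutes_image[of P S' S] assms by auto
  show ?thesis
  proof (rule card_inj_on_le[where f = "\<lambda>f. f \<circ> \<pi>"])
    show "inj_on (\<lambda>f. f \<circ> \<pi>) {f \<in> assignments P B d. {p \<in> P. f p \<in> Y} = S}"
      using \<pi>(1) by (rule inj_on_comp_permutes)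
    show "(\<lambda>f. f \<circ> \<pi>) ` {f \<in> assignments P B d. {p \<in> P. f p \<in> Y} = S}
        \<subseteq> {f \<in> assignments P B d. {p \<in> P. f p \<in> Y} = S'}"
    proof (clarsimp simp: assignments_permute[OF _ \<pi>(1)])
      fix f assume "S = {p \<in> P. f p \<in> Y}"
      then have "{p \<in> P. \<pi> p \<in> S} = {p \<in> P. f (\<pi> p) \<in> Y}"
        using permutes_in_image[OF \<pi>(1)] by auto
      moreover have "{p \<in> P. \<pi> p \<in> S} = S'"
        using \<pi> assms permutes_inj[OF \<pi>(1)] by (auto simp: inj_def)
      ultimately show "{p \<in> P. f (\<pi> p) \<in> Y} = S'" by simp
    qed
  qed (use assms in auto)
qed

lemma card_assignment_preimage:
  assumes "finite P" "f \<in> assignments P B d" "Y \<subseteq> B" "finite B"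
  shows "card {p \<in> P. f p \<in> Y} = card Y * d"
proof -
  have "{p \<in> P. f p \<in> Y} = (\<Union>w\<in>Y. {p \<in> P. f p = w})" by auto
  also have "card \<dots> = (\<Sum>w\<in>Y. card {p \<in> P. f p = w})"
    using assms by (intro card_UN_disjoint) (auto intro: finite_subset)
  also have "\<dots> = (\<Sum>w\<in>Y. d)"
    using assms by (intro sum.cong) (auto simp: assignments_def)
  finally show ?thesis by simp
qed

text \<open>The preimage of \<open>Y\<close> always has \<open>card Y * d\<close> points, and by
  symmetry every set of that size occurs equally often. This is the probability
  \<open>1 / (card P choose (card Y * d))\<close> in product form.\<close>

lemma card_assignments_preimage:
  assumes fin: "finite P" "finite B" and Y: "Y \<subseteq> B" and S: "S \<subseteq> P" "card S = card Y * d"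
  shows "card {f \<in> assignments P B d. {p \<in> P. f p \<in> Y} = S} * (card P choose (card Y * d))
       = card (assignments P B d)"
proof -
  define \<S> where "\<S> = {T. T \<subseteq> P \<and> card T = card Y * d}"
  have \<S>: "finite \<S>" "card \<S> = (card P choose (card Y * d))"
    using fin n_subsets[of P] by (auto simp: \<S>_def)
  have eq: "card {f \<in> assignments P B d. {p \<in> P. f p \<in> Y} = T}
     = card {f \<in> assignments P B d. {p \<in> P. f p \<in> Y} = S}" if "T \<in> \<S>" for T
    using that S fin by (intro antisym card_assignments_preimage_le) (auto simp: \<S>_def)
  have "assignments P B d = (\<Union>T\<in>\<S>. {f \<in> assignments P B d. {p \<in> P. f p \<in> Y} = T})"
    using card_assignment_preimage[OF fin(1) _ Y fin(2)] by (auto simp: \<S>_def)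
  moreover have "card (\<Union>T\<in>\<S>. {f \<in> assignments P B d. {p \<in> P. f p \<in> Y} = T})
      = (\<Sum>T\<in>\<S>. card {f \<in> assignments P B d. {p \<in> P. f p \<in> Y} = T})"
    using \<S>(1) fin by (intro card_UN_disjoint) auto
  ultimately have "card (assignments P B d)
      = (\<Sum>T\<in>\<S>. card {f \<in> assignments P B d. {p \<in> P. f p \<in> Y} = T})" by metis
  also have "\<dots> = card {f \<in> assignments P B d. {p \<in> P. f p \<in> Y} = S} * card \<S>"
    using eq by simp
  finally show ?thesis using \<S>(2) by simp
qed

text \<open>A profile leaves \<open>d choose b v\<close> possible traces of the preimage of
  \<open>Y\<close> on the row of \<open>v\<close>, and all preimages are equally likely. The second
  claim supplies the sum condition of the ratio estimates; it is conditional because an arbitrary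
  \<open>b\<close> may be realised by no assignment.\<close>

lemma card_assignments_profile:
  fixes A :: "'a set" and B :: "'b set" and b :: "'a \<Rightarrow> nat" and d :: nat
  assumes fin: "finite A" "finite B" and Y: "Y \<subseteq> B"
  defines "T \<equiv> {f \<in> assignments (A \<times> {..<d}) B d. \<forall>v\<in>A. card {i \<in> {..<d}. f (v, i) \<in> Y} = b v}"
  shows "card T * ((card A * d) choose (card Y * d))
       \<le> card (assignments (A \<times> {..<d}) B d) * (\<Prod>v\<in>A. d choose b v)"
    and "T \<noteq> {} \<Longrightarrow> (\<Sum>v\<in>A. b v) = card Y * d"
proof -
  let ?P = "A \<times> {..<d}"
  let ?F = "\<lambda>S. {f \<in> assignments ?P B d. {p \<in> ?P. f p \<in> Y} = S}"
  define \<S> where "\<S> = {S. S \<subseteq> ?P \<and> card S = card Y * d \<and> (\<forall>v\<in>A. card {i \<in> {..<d}. (v, i) \<in> S} = b v)}"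
  have finP: "finite ?P" using fin by simp
  have "\<S> \<subseteq> (\<lambda>g. Sigma A g) ` (\<Pi>\<^sub>E v\<in>A. {I. I \<subseteq> {..<d} \<and> card I = b v})"
  proof
    fix S assume S: "S \<in> \<S>"
    define g where "g = (\<lambda>v\<in>A. {i \<in> {..<d}. (v, i) \<in> S})"
    have "S = Sigma A g" using S by (auto simp: g_def \<S>_def)
    moreover have "g \<in> (\<Pi>\<^sub>E v\<in>A. {I. I \<subseteq> {..<d} \<and> card I = b v})"
      using S by (auto simp: g_def \<S>_def)
    ultimately show "S \<in> (\<lambda>g. Sigma A g) ` (\<Pi>\<^sub>E v\<in>A. {I. I \<subseteq> {..<d} \<and> card I = b v})" by blast
  qed
  moreover have "finite (\<Pi>\<^sub>E v\<in>A. {I. I \<subseteq> {..<d} \<and> card I = b v})"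
    using fin by (intro finite_PiE) auto
  ultimately have "card \<S> \<le> card (\<Pi>\<^sub>E v\<in>A. {I. I \<subseteq> {..<d} \<and> card I = b v})"
    using surj_card_le by blast
  then have card_\<S>: "card \<S> \<le> (\<Prod>v\<in>A. d choose b v)"
    using fin by (simp add: card_PiE n_subsets)
  have T: "T \<subseteq> (\<Union>S\<in>\<S>. ?F S)"
  proof
    fix f assume f: "f \<in> T"
    have "card {i \<in> {..<d}. (v, i) \<in> {p \<in> ?P. f p \<in> Y}} = b v" if "v \<in> A" for v
      using f that by (auto simp: T_def intro!: arg_cong[where f = card] elim!: ballE[of _ _ v])
    then have "{p \<in> ?P. f p \<in> Y} \<in> \<S>"
      using card_assignment_preimage[OF finP _ Y fin(2), of f d] f by (auto simp: \<S>_def T_def)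
    then show "f \<in> (\<Union>S\<in>\<S>. ?F S)" using f by (auto simp: T_def)
  qed
  have fin\<S>: "finite \<S>"
    unfolding \<S>_def by (rule finite_subset[of _ "Pow ?P"]) (use finP in auto)
  have "card T * (card ?P choose (card Y * d)) \<le> card (\<Union>S\<in>\<S>. ?F S) * (card ?P choose (card Y * d))"
    using T fin\<S> finP fin by (intro mult_le_mono1 card_mono) auto
  also have "\<dots> \<le> (\<Sum>S\<in>\<S>. card (?F S)) * (card ?P choose (card Y * d))"
    using fin\<S> by (intro mult_le_mono1 card_UN_le)
  also have "\<dots> = (\<Sum>S\<in>\<S>. card (assignments ?P B d))"
    unfolding sum_distrib_right
    by (intro sum.cong refl card_assignments_preimage finP fin Y) (auto simp: \<S>_def)
  also have "\<dots> = card (assignments ?P B d) * card \<S>" by simp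
  also have "\<dots> \<le> card (assignments ?P B d) * (\<Prod>v\<in>A. d choose b v)"
    using card_\<S> by simp
  finally show "card T * ((card A * d) choose (card Y * d))
       \<le> card (assignments ?P B d) * (\<Prod>v\<in>A. d choose b v)"
    by (simp add: card_cartesian_product)
  assume "T \<noteq> {}"
  then obtain f where f: "f \<in> T" by auto
  have "(\<Sum>v\<in>A. b v) = (\<Sum>v\<in>A. card {i \<in> {..<d}. f (v, i) \<in> Y})"
    using f by (simp add: T_def)
  also have "\<dots> = card (SIGMA v:A. {i \<in> {..<d}. f (v, i) \<in> Y})"
    using fin by simp
  also have "(SIGMA v:A. {i \<in> {..<d}. f (v, i) \<in> Y}) = {p \<in> ?P. f p \<in> Y}" by auto
  also have "card \<dots> = card Y * d"
    using card_assignment_preimage[OF finP _ Y fin(2)] f by (auto simp: T_def)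
  finally show "(\<Sum>v\<in>A. b v) = card Y * d" .
qed

section \<open>Collisions and the cost of simplicity\<close>

lemma sum_card_swap:
  assumes "finite F" "finite X"
  shows "(\<Sum>f\<in>F. card {x \<in> X. Q f x}) = (\<Sum>x\<in>X. card {f \<in> F. Q f x})"
  using assms by (simp add: card_eq_sum sum.inter_filter del: sum_constant) (rule sum.swap)

definition row :: "('a \<times> 'i) set \<Rightarrow> 'a \<times> 'i \<Rightarrow> ('a \<times> 'i) set" where
  "row P p = {q \<in> P. fst q = fst p}"

text \<open>A collision is a multiple edge of the multigraph encoded by \<open>f\<close>. The pairs
  are ordered, so each one is listed in both directions.\<close>

definition collisions :: "('a \<times> 'i) set \<Rightarrow> ('a \<times> 'i \<Rightarrow> 'b) \<Rightarrow> (('a \<times> 'i) \<times> ('a \<times> 'i)) set" where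
  "collisions P f = {(p, q). p \<in> P \<and> q \<in> row P p \<and> p \<noteq> q \<and> f p = f q}"

lemma finite_collisions [simp]: "finite P \<Longrightarrow> finite (collisions P f)"
  by (rule finite_subset[of _ "P \<times> P"]) (auto simp: collisions_def row_def)

lemma card_row: "p \<in> A \<times> {..<d} \<Longrightarrow> card (row (A \<times> {..<d}) p) = d"
proof -
  assume "p \<in> A \<times> {..<d}"
  then have "row (A \<times> {..<d}) p = {fst p} \<times> {..<d}" by (auto simp: row_def)
  then show ?thesis by (simp add: card_cartesian_product)
qed

text \<open>With \<open>p\<close> fixed, transpositions that avoid \<open>p\<close> show that all
  other points share its value equally often, and in every assignment exactly \<open>d - 1\<close>
  points do. The probability is therefore \<open>(d - 1) / (card P - 1)\<close>.\<close>

lemma card_assignments_collide: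
  fixes P :: "'p set"
  assumes fin: "finite P" "finite B" and pq: "p \<in> P" "q \<in> P" "p \<noteq> q" and "d \<ge> 1"
  shows "card {f \<in> assignments P B d. f p = f q} * (card P - 1) = (d - 1) * card (assignments P B d)"
proof -
  let ?F = "assignments P B d"
  let ?c = "\<lambda>q. card {f \<in> ?F. f q = f p}"
  have le: "?c x \<le> ?c y" if "x \<in> P - {p}" "y \<in> P - {p}" for x y
  proof (rule card_inj_on_le[where f = "\<lambda>f. f \<circ> Transposition.transpose x y"])
    have t: "Transposition.transpose x y permutes P" using that by (intro permutes_swap_id) auto
    show "inj_on (\<lambda>f. f \<circ> Transposition.transpose x y) {f \<in> ?F. f x = f p}"
      using t by (rule inj_on_comp_permutes)
    show "(\<lambda>f. f \<circ> Transposition.transpose x y) ` {f \<in> ?F. f x = f p} \<subseteq> {f \<in> ?F. f y = f p}"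
      using that by (auto simp: assignments_permute[OF _ t] transpose_apply_other)
  qed (use fin in auto)
  have c: "?c x = ?c q" if "x \<in> P - {p}" for x
    using le[OF that, of q] le[OF _ that, of q] pq by (intro antisym) auto
  have "?c q * (card P - 1) = (\<Sum>x\<in>P-{p}. ?c q)" using pq fin by simp
  also have "\<dots> = (\<Sum>x\<in>P-{p}. ?c x)" by (rule sum.cong[OF refl c[symmetric]])
  also have "\<dots> = (\<Sum>f\<in>?F. card {x \<in> P - {p}. f x = f p})"
    using fin by (intro sum_card_swap[symmetric]) auto
  also have "\<dots> = (\<Sum>f\<in>?F. d - 1)"
  proof (rule sum.cong)
    fix f assume f: "f \<in> ?F"
    then have "f p \<in> B" using pq(1) by (auto simp: assignments_def)
    with f have "card {x \<in> P. f x = f p} = d" by (simp add: assignments_def)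
    moreover have "{x \<in> P - {p}. f x = f p} = {x \<in> P. f x = f p} - {p}" by auto
    ultimately show "card {x \<in> P - {p}. f x = f p} = d - 1" using pq fin by simp
  qed simp
  also have "\<dots> = (d - 1) * card ?F" by simp
  finally show ?thesis by (simp add: eq_commute)
qed

text \<open>The mean number of collisions is bounded independently of \<open>card A\<close>: at most
  \<open>card P * d\<close> pairs lie in a common row, each collides with probability at most
  \<open>d / (card P - 1)\<close>, and \<open>card P \<le> 2 * (card P - 1)\<close>.\<close>

lemma sum_card_collisions_le:
  fixes A :: "'a set" and B :: "'b set" and d :: nat
  defines "P \<equiv> A \<times> {..<d}"
  assumes fin: "finite A" "finite B" and "d \<ge> 1" "card A \<ge> 2"
  shows "(\<Sum>f\<in>assignments P B d. card (collisions P f)) \<le> 2 * d\<^sup>2 * card (assignments P B d)"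
proof -
  let ?F = "assignments P B d"
  have finP: "finite P" and cP: "card P = card A * d"
    using fin by (auto simp: P_def card_cartesian_product)
  define R where "R = (SIGMA p:P. row P p - {p})"
  have finR: "finite R" using finP by (auto simp: R_def row_def)
  have "card R = (\<Sum>p\<in>P. card (row P p - {p}))"
    unfolding R_def using finP by (subst card_SigmaI) (auto simp: row_def)
  also have "\<dots> \<le> (\<Sum>p\<in>P. d)"
    using card_row[of _ A d] finP unfolding P_def[symmetric]
    by (intro sum_mono) (metis card_Diff1_le)
  finally have R: "card R \<le> card P * d" by simp
  have "(\<Sum>f\<in>?F. card (collisions P f)) = (\<Sum>f\<in>?F. card {x \<in> R. f (fst x) = f (snd x)})"
    by (intro sum.cong refl arg_cong[where f = card]) (auto simp: collisions_def R_def)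
  also have "\<dots> = (\<Sum>x\<in>R. card {f \<in> ?F. f (fst x) = f (snd x)})"
    using finP finR fin by (intro sum_card_swap) auto
  finally have "(\<Sum>f\<in>?F. card (collisions P f)) * (card P - 1)
     = (\<Sum>x\<in>R. card {f \<in> ?F. f (fst x) = f (snd x)} * (card P - 1))"
    by (simp add: sum_distrib_right)
  also have "\<dots> = (\<Sum>x\<in>R. (d - 1) * card ?F)"
    using finP fin assms(4)
    by (intro sum.cong refl card_assignments_collide) (auto simp: R_def row_def)
  also have "\<dots> \<le> (card P * d) * (d * card ?F)"
    using R by (simp add: mult_le_mono)
  also have "card P * d \<le> (2 * (card P - 1)) * d"
  proof -
    have "2 * 1 \<le> card P" unfolding cP using assms by (intro mult_le_mono) auto
    then show ?thesis by (intro mult_le_mono1) linarith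
  qed
  finally have "(card P - 1) * (\<Sum>f\<in>?F. card (collisions P f)) \<le> (card P - 1) * (2 * d\<^sup>2 * card ?F)"
    by (simp add: power2_eq_square mult_ac)
  moreover have "card P - 1 > 0"
  proof -
    have "2 * 1 \<le> card P" unfolding cP using assms by (intro mult_le_mono) auto
    then show ?thesis by simp
  qed
  ultimately show ?thesis by simp
qed

text \<open>Markov's inequality at twice the bound on the mean.\<close>

lemma card_assignments_few_collisions:
  fixes A :: "'a set" and B :: "'b set" and d :: nat
  defines "P \<equiv> A \<times> {..<d}"
  assumes fin: "finite A" "finite B" and "d \<ge> 1" "card A \<ge> 2"
  shows "card (assignments P B d)
    \<le> 2 * card {f \<in> assignments P B d. card (collisions P f) \<le> 4 * d\<^sup>2}"
proof -
  let ?F = "assignments P B d"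
  let ?few = "{f \<in> ?F. card (collisions P f) \<le> 4 * d\<^sup>2}"
  have finF: "finite ?F" using fin by (auto simp: P_def)
  have "card (?F - ?few) * (4 * d\<^sup>2) = (\<Sum>f\<in>?F - ?few. 4 * d\<^sup>2)" by simp
  also have "\<dots> \<le> (\<Sum>f\<in>?F - ?few. card (collisions P f))" by (intro sum_mono) auto
  also have "\<dots> \<le> (\<Sum>f\<in>?F. card (collisions P f))" using finF by (intro sum_mono2) auto
  also have "\<dots> \<le> 2 * d\<^sup>2 * card ?F"
    using sum_card_collisions_le[OF fin assms(4,5)] by (simp add: P_def)
  finally have "(2 * d\<^sup>2) * (2 * card (?F - ?few)) \<le> (2 * d\<^sup>2) * card ?F" by (simp add: mult_ac)
  then have "2 * card (?F - ?few) \<le> card ?F" using assms(4) by simp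
  moreover have "card (?F - ?few) = card ?F - card ?few"
    using finF by (intro card_Diff_subset) auto
  moreover have "card ?few \<le> card ?F" using finF by (intro card_mono) auto
  ultimately show ?thesis by linarith
qed

text \<open>Exchanging the values at \<open>p\<close> and \<open>r\<close> destroys the collision at \<open>p\<close> and creates none if
  neither value already occurs in its new row.\<close>

lemma collisions_transpose:
  fixes f :: "'a \<times> 'i \<Rightarrow> 'b"
  assumes "p \<in> P" "r \<in> P" "f r \<notin> f ` row P p" "f p \<notin> f ` row P r"
    and col: "(p, q) \<in> collisions P f" and "finite P"
  shows "card (collisions P (f \<circ> Transposition.transpose p r)) < card (collisions P f)"
proof (rule psubset_card_mono)
  let ?g = "f \<circ> Transposition.transpose p r"
  have ne: "fst r \<noteq> fst p" using assms by (auto simp: row_def)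
  have g: "?g p = f r" "?g r = f p" by simp_all
  have other: "?g x = f x" if "x \<noteq> p" "x \<noteq> r" for x using that by (simp add: transpose_apply_other)
  have nin: "f r \<noteq> f y" if "y \<in> P" "fst y = fst p" for y using assms(3) that by (auto simp: row_def)
  have nin': "f p \<noteq> f y" if "y \<in> P" "fst y = fst r" for y using assms(4) that by (auto simp: row_def)
  have *: "(x, y) \<in> collisions P f \<and> x \<noteq> p \<and> y \<noteq> p" if xy: "(x, y) \<in> collisions P ?g" for x y
  proof -
    have h: "x \<in> P" "y \<in> P" "fst y = fst x" "x \<noteq> y" "?g x = ?g y"
      using xy by (auto simp: collisions_def row_def simp del: comp_apply)
    have "x \<noteq> p" using h nin[of y] g ne other[of y] by metis
    moreover have "y \<noteq> p" using h nin[of x] g ne other[of x] by metis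
    moreover have "x \<noteq> r" using h nin'[of y] g ne other[of y] by metis
    moreover have "y \<noteq> r" using h nin'[of x] g ne other[of x] by metis
    ultimately show ?thesis using h other by (auto simp: collisions_def row_def simp del: comp_apply)
  qed
  then have "collisions P ?g \<subseteq> collisions P f" by auto
  moreover have "(p, q) \<notin> collisions P ?g" using * by blast
  ultimately show "collisions P ?g \<subset> collisions P f" using col by blast
qed (use assms in simp)

text \<open>A switching argument. An assignment with \<open>Suc j\<close> collisions loses at least
  one when the value at a colliding point \<open>p f\<close> is exchanged with that at a suitable
  \<open>r\<close>. At most \<open>2 * d^2\<close> points \<open>r\<close> are unsuitable and
  \<open>card P \<ge> 4 * d^2\<close>, so at least half of them are good. Conversely, the new
  assignment and \<open>p f\<close> leave at most \<open>d^2\<close> candidates for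
  \<open>r\<close>. In the double count \<open>card P\<close> cancels and the factor
  \<open>2 * d^2\<close> remains.\<close>

lemma card_collisions_step:
  fixes A :: "'a set" and B :: "'b set" and d :: nat
  defines "P \<equiv> A \<times> {..<d}"
  defines "N \<equiv> \<lambda>j. {f \<in> assignments P B d. card (collisions P f) \<le> j}"
  assumes fin: "finite A" "finite B" and d: "d \<ge> 1" and n: "card A \<ge> 4 * d"
  shows "card (N (Suc j)) \<le> (1 + 2 * d\<^sup>2) * card (N j)"
proof -
  let ?F = "assignments P B d"
  let ?L = "{f \<in> ?F. card (collisions P f) = Suc j}"
  have finP: "finite P" and cP: "card P = card A * d"
    using fin by (auto simp: P_def card_cartesian_product)
  have finF: "finite ?F" using fin finP by simp
  have hit: "card {r \<in> P. f r \<in> f ` row P p} \<le> d * d" if "f \<in> ?F" "p \<in> P" for f p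
  proof -
    have "f ` row P p \<subseteq> B" using that by (auto simp: assignments_def row_def)
    then have "card {r \<in> P. f r \<in> f ` row P p} = card (f ` row P p) * d"
      by (rule card_assignment_preimage[OF finP that(1) _ fin(2)])
    also have "\<dots> \<le> card (row P p) * d"
      using finP by (intro mult_le_mono1 card_image_le) (auto simp: row_def)
    also have "card (row P p) = d" using that unfolding P_def by (intro card_row)
    finally show ?thesis .
  qed
  have "\<exists>p q. (p, q) \<in> collisions P f" if "f \<in> ?L" for f
  proof -
    have "collisions P f \<noteq> {}" using that by auto
    then show ?thesis by (metis ex_in_conv surj_pair)
  qed
  then have "\<forall>f\<in>?L. \<exists>p q. (p, q) \<in> collisions P f" by blast
  then obtain p where "\<forall>f\<in>?L. \<exists>q. (p f, q) \<in> collisions P f"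
    using bchoice[of ?L "\<lambda>f p. \<exists>q. (p, q) \<in> collisions P f"] by blast
  then have p: "\<exists>q. (p f, q) \<in> collisions P f" if "f \<in> ?L" for f using that by blast
  have pP: "p f \<in> P" if "f \<in> ?L" for f using p[OF that] by (auto simp: collisions_def)
  define good where "good f = {r \<in> P. f r \<notin> f ` row P (p f) \<and> f (p f) \<notin> f ` row P r}" for f
  have good: "card P \<le> 2 * card (good f)" if f: "f \<in> ?L" for f
  proof -
    let ?B1 = "{r \<in> P. f r \<in> f ` row P (p f)}"
    let ?B2 = "{r \<in> P. f (p f) \<in> f ` row P r}"
    let ?Y = "{y \<in> P. f y = f (p f)}"
    have "?B2 \<subseteq> (\<Union>y\<in>?Y. row P y)" by (auto simp: row_def)
    then have "card ?B2 \<le> card (\<Union>y\<in>?Y. row P y)"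
      using finP by (intro card_mono) (auto simp: row_def)
    also have "\<dots> \<le> (\<Sum>y\<in>?Y. card (row P y))" using finP by (intro card_UN_le) auto
    also have "\<dots> = (\<Sum>y\<in>?Y. d)" by (intro sum.cong refl) (auto simp: P_def card_row)
    also have "\<dots> = d * d"
    proof -
      have "f (p f) \<in> B" using f pP[OF f] by (auto simp: assignments_def)
      then have "card ?Y = d" using f by (simp add: assignments_def)
      then show ?thesis by simp
    qed
    finally have B2: "card ?B2 \<le> d * d" .
    have B1: "card ?B1 \<le> d * d" using hit f pP[OF f] by auto
    have "card P \<le> card (good f \<union> (?B1 \<union> ?B2))"
      using finP by (intro card_mono) (auto simp: good_def)
    also have "\<dots> \<le> card (good f) + card (?B1 \<union> ?B2)" by (rule card_Un_le)
    also have "card (?B1 \<union> ?B2) \<le> d * d + d * d"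
      using card_Un_le[of ?B1 ?B2] B1 B2 by linarith
    finally have "card P \<le> card (good f) + (d * d + d * d)" by simp
    moreover have "4 * d * d \<le> card P" unfolding cP using n by (rule mult_le_mono1)
    ultimately show ?thesis by (simp add: mult.assoc)
  qed
  \<comment> \<open>A member of \<open>Z\<close> records the new assignment, the point
    \<open>p f\<close> and \<open>r\<close>, from which the exchange can be undone. The condition on
    \<open>r\<close> cuts its range from \<open>card P\<close> to \<open>d * d\<close>, and this
    saves the factor that would depend on \<open>card A\<close>.\<close>
  define Z where "Z = (SIGMA x:N j \<times> P. {r \<in> P. fst x r \<in> fst x ` row P (snd x)})"
  have finN: "finite (N j)" using finF by (simp add: N_def)
  have "card Z = (\<Sum>x\<in>N j \<times> P. card {r \<in> P. fst x r \<in> fst x ` row P (snd x)})"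
    unfolding Z_def using finN finP by simp
  also have "\<dots> \<le> (\<Sum>x\<in>N j \<times> P. d * d)"
    using hit by (intro sum_mono) (auto simp: N_def)
  finally have cZ: "card Z \<le> card (N j) * card P * (d * d)"
    by (simp add: card_cartesian_product)
  have "card (SIGMA f:?L. good f) \<le> card Z"
  proof (rule card_inj_on_le)
    let ?h = "\<lambda>(f, r). ((f \<circ> Transposition.transpose (p f) r, p f), r)"
    show "inj_on ?h (SIGMA f:?L. good f)"
    proof (rule inj_onI, clarsimp)
      fix f f' r assume "f \<circ> Transposition.transpose (p f') r = f' \<circ> Transposition.transpose (p f') r"
      then have "f \<circ> Transposition.transpose (p f') r \<circ> Transposition.transpose (p f') r
         = f' \<circ> Transposition.transpose (p f') r \<circ> Transposition.transpose (p f') r" by simp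
      then show "f = f'" by (simp only: comp_assoc transpose_comp_involutory comp_id)
    qed
    show "?h ` (SIGMA f:?L. good f) \<subseteq> Z"
    proof (rule image_subsetI)
      fix x assume "x \<in> (SIGMA f:?L. good f)"
      then obtain f r where x: "x = (f, r)" and fL: "f \<in> ?L" and r: "r \<in> good f" by blast
      then have f: "f \<in> ?F" "card (collisions P f) = Suc j" by auto
      let ?g = "f \<circ> Transposition.transpose (p f) r"
      obtain q where q: "(p f, q) \<in> collisions P f" using p[OF fL] by auto
      have rP: "r \<in> P" using r by (simp add: good_def)
      have "card (collisions P ?g) < card (collisions P f)"
        using r pP[OF fL] q finP by (intro collisions_transpose) (auto simp: good_def)
      moreover have "?g \<in> ?F"
        using f(1) permutes_swap_id[OF pP[OF fL] rP] by (rule assignments_permute)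
      ultimately have "?g \<in> N j" using f by (simp add: N_def)
      \<comment> \<open>After the exchange \<open>r\<close> carries the old value of
        \<open>p f\<close>, which is still present at the former partner \<open>q\<close> in the row
        of \<open>p f\<close>.\<close>
      moreover have "?g r \<in> ?g ` row P (p f)"
      proof -
        have q': "q \<in> row P (p f)" "q \<noteq> p f" "f q = f (p f)" using q by (auto simp: collisions_def)
        moreover have "q \<noteq> r" using q' r by (auto simp: good_def)
        ultimately have "?g q = ?g r" by (simp add: transpose_apply_other)
        then show ?thesis using q' by (metis imageI)
      qed
      ultimately show "?h x \<in> Z"
        using pP[OF fL] rP by (simp add: Z_def x)
    qed
    show "finite Z" using finN finP by (auto simp: Z_def)
  qed
  moreover have "card ?L * card P \<le> 2 * card (SIGMA f:?L. good f)"
  proof -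
    have "card ?L * card P = (\<Sum>f\<in>?L. card P)" by simp
    also have "\<dots> \<le> (\<Sum>f\<in>?L. 2 * card (good f))" using good by (intro sum_mono)
    also have "\<dots> = 2 * card (SIGMA f:?L. good f)"
      using finF finP by (subst card_SigmaI) (auto simp: good_def sum_distrib_left)
    finally show ?thesis .
  qed
  ultimately have "card ?L * card P \<le> 2 * card Z" by linarith
  also have "\<dots> \<le> 2 * (card (N j) * card P * (d * d))" using cZ by (rule mult_le_mono2)
  finally have "card P * card ?L \<le> card P * (2 * d\<^sup>2 * card (N j))"
    by (simp only: power2_eq_square mult_ac)
  moreover have "card P > 0" unfolding cP using d n by simp
  ultimately have "card ?L \<le> 2 * d\<^sup>2 * card (N j)" by simp
  moreover have "card (N (Suc j)) \<le> card ?L + card (N j)"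
  proof -
    have "N (Suc j) = ?L \<union> N j" by (auto simp: N_def)
    then show ?thesis by (simp only: card_Un_le)
  qed
  ultimately show ?thesis by (simp add: algebra_simps)
qed

definition simple_assignments :: "'a set \<Rightarrow> 'b set \<Rightarrow> nat \<Rightarrow> ('a \<times> nat \<Rightarrow> 'b) set" where
  "simple_assignments A B d =
     {f \<in> assignments (A \<times> {..<d}) B d. \<forall>v\<in>A. inj_on (\<lambda>i. f (v, i)) {..<d}}"

text \<open>The factor 2 is the loss in Markov's inequality. The power comes from descending from
  \<open>4 * d^2\<close> collisions to none, with one factor \<open>1 + 2 * d^2\<close> per
  level.\<close>

definition simplicity_constant :: "nat \<Rightarrow> nat" where
  "simplicity_constant d = 2 * (1 + 2 * d\<^sup>2) ^ (4 * d\<^sup>2)"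

lemma card_assignments_le_simple:
  fixes A :: "'a set" and B :: "'b set" and d :: nat
  assumes fin: "finite A" "finite B" and d: "d \<ge> 1" and n: "card A \<ge> 4 * d"
  shows "card (assignments (A \<times> {..<d}) B d) \<le> simplicity_constant d * card (simple_assignments A B d)"
proof -
  let ?P = "A \<times> {..<d}"
  define N where "N j = {f \<in> assignments ?P B d. card (collisions ?P f) \<le> j}" for j
  have "card (N j) \<le> (1 + 2 * d\<^sup>2) ^ j * card (N 0)" for j
  proof (induction j)
    case (Suc j)
    have "card (N (Suc j)) \<le> (1 + 2 * d\<^sup>2) * card (N j)"
      unfolding N_def by (rule card_collisions_step[OF fin d n])
    also have "\<dots> \<le> (1 + 2 * d\<^sup>2) * ((1 + 2 * d\<^sup>2) ^ j * card (N 0))"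
      using Suc by (rule mult_le_mono2)
    finally show ?case by (simp only: power_Suc mult.assoc)
  qed simp
  moreover have "card (assignments ?P B d) \<le> 2 * card (N (4 * d\<^sup>2))"
    unfolding N_def using d n by (intro card_assignments_few_collisions fin) auto
  ultimately have "card (assignments ?P B d) \<le> simplicity_constant d * card (N 0)"
    unfolding simplicity_constant_def by (metis (no_types, lifting) mult.assoc mult_le_mono2 order_trans)
  moreover have "N 0 = simple_assignments A B d"
  proof -
    have "collisions ?P f = {} \<longleftrightarrow> (\<forall>v\<in>A. inj_on (\<lambda>i. f (v, i)) {..<d})" for f :: "'a \<times> nat \<Rightarrow> 'b"
    proof
      assume e: "collisions ?P f = {}"
      show "\<forall>v\<in>A. inj_on (\<lambda>i. f (v, i)) {..<d}"
      proof (intro ballI inj_onI, rule ccontr)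
        fix v i j assume "v \<in> A" "i \<in> {..<d}" "j \<in> {..<d}" "f (v, i) = f (v, j)" "i \<noteq> j"
        then have "((v, i), (v, j)) \<in> collisions ?P f" by (simp add: collisions_def row_def)
        with e show False by blast
      qed
    next
      assume "\<forall>v\<in>A. inj_on (\<lambda>i. f (v, i)) {..<d}"
      then show "collisions ?P f = {}"
        unfolding collisions_def row_def inj_on_def by (clarsimp; metis lessThan_iff)
    qed
    then show ?thesis
      using fin by (auto simp: N_def simple_assignments_def)
  qed
  ultimately show ?thesis by simp
qed

subsection \<open>Bipartite regular graphs\<close>

text \<open>The witness sends all points of a vertex to one value, so for \<open>d > 1\<close> it is
  far from simple. It is enough nevertheless: the comparison with simple assignments turns the
  existence of any assignment into that of a simple one, hence of a regular bipartite graph.\<close>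

lemma assignments_nonempty:
  assumes "finite A" "finite B" "card A = card B"
  shows "assignments (A \<times> {..<d}) B d \<noteq> {}"
proof -
  obtain h where h: "bij_betw h A B" using finite_same_card_bij[OF assms] by (elim exE)
  define f where "f = (\<lambda>p\<in>A \<times> {..<d}. h (fst p))"
  have "card {p \<in> A \<times> {..<d}. f p = w} = d" if "w \<in> B" for w
  proof -
    have "w \<in> h ` A" using bij_betw_imp_surj_on[OF h] that by simp
    then obtain v where v: "v \<in> A" "h v = w" by auto
    have "{p \<in> A \<times> {..<d}. f p = w} = {v} \<times> {..<d}"
      using v h by (auto simp: f_def bij_betw_def inj_on_def)
    then show ?thesis by (simp add: card_cartesian_product)
  qed
  moreover have "f \<in> A \<times> {..<d} \<rightarrow>\<^sub>E B" using h by (auto simp: f_def bij_betw_def)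
  ultimately show ?thesis by (auto simp: assignments_def)
qed

definition nbrs :: "nat set set \<Rightarrow> nat \<Rightarrow> nat set" where
  "nbrs E v = {w. {v, w} \<in> E}"

definition bip_edges :: "nat set \<Rightarrow> nat set \<Rightarrow> nat set set" where
  "bip_edges A B = {{a, b} | a b. a \<in> A \<and> b \<in> B}"

lemma nbrs_bip_subset: "E \<subseteq> bip_edges A B \<Longrightarrow> A \<inter> B = {} \<Longrightarrow> v \<in> A \<Longrightarrow> nbrs E v \<subseteq> B"
  by (auto simp: nbrs_def bip_edges_def doubleton_eq_iff dest!: subsetD)

text \<open>The predicate \<open>Q\<close> lets one count serve for the plain degree, for the edges
  at \<open>v\<close> inside a set and for those meeting it.\<close>

lemma card_edges_at:
  assumes "E \<subseteq> bip_edges A B" "A \<inter> B = {}" "v \<in> A"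
  shows "card {e \<in> E. v \<in> e \<and> Q e} = card {w \<in> nbrs E v. Q {v, w}}"
proof -
  have "{e \<in> E. v \<in> e \<and> Q e} = (\<lambda>w. {v, w}) ` {w \<in> nbrs E v. Q {v, w}}"
  proof (intro equalityI subsetI)
    fix e assume e: "e \<in> {e \<in> E. v \<in> e \<and> Q e}"
    then obtain a b where ab: "e = {a, b}" "a \<in> A" "b \<in> B" using assms by (auto simp: bip_edges_def)
    then have "v = a" using e assms by auto
    then show "e \<in> (\<lambda>w. {v, w}) ` {w \<in> nbrs E v. Q {v, w}}" using ab e by (auto simp: nbrs_def)
  qed (auto simp: nbrs_def)
  then show ?thesis
    by (simp add: card_image inj_on_def doubleton_eq_iff)
qed

lemma degree_in_left:
  assumes "E \<subseteq> bip_edges A B" "A \<inter> B = {}" "v \<in> A"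
  shows "degree_in E v = card (nbrs E v)"
  using card_edges_at[OF assms, of "\<lambda>_. True"] by (simp add: degree_in_def)

lemma degree_in_right:
  assumes "E \<subseteq> bip_edges A B" "A \<inter> B = {}" "w \<in> B"
  shows "degree_in E w = card {v \<in> A. w \<in> nbrs E v}"
proof -
  have "{e \<in> E. w \<in> e} = (\<lambda>v. {v, w}) ` {v \<in> A. w \<in> nbrs E v}"
  proof (intro equalityI subsetI)
    fix e assume e: "e \<in> {e \<in> E. w \<in> e}"
    then obtain a b where ab: "e = {a, b}" "a \<in> A" "b \<in> B" using assms by (auto simp: bip_edges_def)
    then have "w = b" using e assms by auto
    then show "e \<in> (\<lambda>v. {v, w}) ` {v \<in> A. w \<in> nbrs E v}" using ab e by (auto simp: nbrs_def)
  qed (auto simp: nbrs_def)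
  then show ?thesis
    by (simp add: degree_in_def card_image inj_on_def doubleton_eq_iff)
qed

lemma bip_edges_eqI:
  assumes "E \<subseteq> bip_edges A B" "E' \<subseteq> bip_edges A B" "\<And>v. v \<in> A \<Longrightarrow> nbrs E v = nbrs E' v"
  shows "E = E'"
proof -
  have "X \<subseteq> X'" if "X \<subseteq> bip_edges A B" "\<And>v. v \<in> A \<Longrightarrow> nbrs X v = nbrs X' v" for X X'
  proof
    fix e assume e: "e \<in> X"
    with that(1) have "e \<in> bip_edges A B" by blast
    then obtain a b where ab: "e = {a, b}" "a \<in> A" by (auto simp: bip_edges_def)
    then have "b \<in> nbrs X a" using e by (simp add: nbrs_def)
    then have "b \<in> nbrs X' a" using that(2)[OF ab(2)] by simp
    then show "e \<in> X'" using ab by (simp add: nbrs_def)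
  qed
  then show ?thesis using assms by (metis subset_antisym)
qed

lemma bip_regular_graph_iff:
  assumes "A \<inter> B = {}"
  shows "bip_regular_graph A B d E \<longleftrightarrow> E \<subseteq> bip_edges A B \<and>
    (\<forall>v\<in>A. card (nbrs E v) = d) \<and> (\<forall>w\<in>B. card {v \<in> A. w \<in> nbrs E v} = d)"
  using degree_in_left[OF _ assms] degree_in_right[OF _ assms]
  unfolding bip_regular_graph_def bip_edges_def[symmetric] by (metis UnE UnI1 UnI2)

section \<open>Regular graphs as classes of simple assignments\<close>

definition neighbour_orderings :: "nat set \<Rightarrow> nat set \<Rightarrow> nat \<Rightarrow> nat set set \<Rightarrow> (nat \<times> nat \<Rightarrow> nat) set" where
  "neighbour_orderings A B d E =
     {f \<in> (A \<times> {..<d}) \<rightarrow>\<^sub>E B. \<forall>v\<in>A. bij_betw (\<lambda>i. f (v, i)) {..<d} (nbrs E v)}"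

text \<open>Each row is injective, so it takes the value \<open>w\<close> at most once; points with
  value \<open>w\<close> correspond to the rows that contain it.\<close>

lemma card_preimage_rows:
  assumes "\<And>v. v \<in> A \<Longrightarrow> bij_betw (\<lambda>i. f (v, i)) {..<d} (N v)"
  shows "card {p \<in> A \<times> {..<d}. f p = w} = card {v \<in> A. w \<in> N v}"
proof (rule bij_betw_same_card)
  show "bij_betw fst {p \<in> A \<times> {..<d}. f p = w} {v \<in> A. w \<in> N v}"
    unfolding bij_betw_def
  proof
    show "inj_on fst {p \<in> A \<times> {..<d}. f p = w}"
    proof (rule inj_onI, clarsimp)
      fix v i j assume "v \<in> A" "i < d" "j < d" "f (v, j) = f (v, i)"
      then show "i = j" using bij_betw_imp_inj_on[OF assms[of v]] by (auto dest: inj_onD)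
    qed
    show "fst ` {p \<in> A \<times> {..<d}. f p = w} = {v \<in> A. w \<in> N v}"
    proof (intro equalityI subsetI)
      fix v assume "v \<in> {v \<in> A. w \<in> N v}"
      then have v: "v \<in> A" "w \<in> (\<lambda>i. f (v, i)) ` {..<d}"
        using bij_betw_imp_surj_on[OF assms[of v]] by auto
      then show "v \<in> fst ` {p \<in> A \<times> {..<d}. f p = w}" by force
    next
      fix v assume "v \<in> fst ` {p \<in> A \<times> {..<d}. f p = w}"
      then obtain i where "v \<in> A" "i \<in> {..<d}" "f (v, i) = w" by auto
      then show "v \<in> {v \<in> A. w \<in> N v}" using bij_betwE[OF assms[of v]] by blast
    qed
  qed
qed

lemma finite_bip_regular_graphs:
  assumes "finite A" "finite B"
  shows "finite {E. bip_regular_graph A B d E}"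
proof (rule finite_subset)
  have "bip_edges A B \<subseteq> (\<lambda>(a, b). {a, b}) ` (A \<times> B)" by (auto simp: bip_edges_def)
  then show "finite (Pow (bip_edges A B))" using assms by (simp add: finite_subset)
qed (auto simp: bip_regular_graph_def bip_edges_def)

lemma neighbour_orderings_simple:
  assumes "A \<inter> B = {}" "bip_regular_graph A B d E" "f \<in> neighbour_orderings A B d E"
  shows "f \<in> simple_assignments A B d"
proof -
  have b: "bij_betw (\<lambda>i. f (v, i)) {..<d} (nbrs E v)" if "v \<in> A" for v
    using assms(3) that by (auto simp: neighbour_orderings_def)
  have "card {p \<in> A \<times> {..<d}. f p = w} = d" if "w \<in> B" for w
    using card_preimage_rows[OF b, of A w] assms(2) that bip_regular_graph_iff[OF assms(1)] by simp
  then show ?thesis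
    using assms(3) b by (auto simp: simple_assignments_def assignments_def neighbour_orderings_def bij_betw_def)
qed

lemma simple_neighbour_orderings:
  assumes "A \<inter> B = {}" "f \<in> simple_assignments A B d"
  shows "\<exists>E. bip_regular_graph A B d E \<and> f \<in> neighbour_orderings A B d E"
proof -
  define E where "E = (\<lambda>p. {fst p, f p}) ` (A \<times> {..<d})"
  have f: "f \<in> (A \<times> {..<d}) \<rightarrow>\<^sub>E B" "\<And>w. w \<in> B \<Longrightarrow> card {p \<in> A \<times> {..<d}. f p = w} = d"
    "\<And>v. v \<in> A \<Longrightarrow> inj_on (\<lambda>i. f (v, i)) {..<d}"
    using assms(2) by (auto simp: simple_assignments_def assignments_def)
  have EB: "E \<subseteq> bip_edges A B" using f(1) by (fastforce simp: E_def bip_edges_def)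
  have "nbrs E v = (\<lambda>i. f (v, i)) ` {..<d}" if "v \<in> A" for v
  proof (intro equalityI subsetI)
    fix w assume w: "w \<in> nbrs E v"
    then obtain u i where ui: "u \<in> A" "i < d" "{v, w} = {u, f (u, i)}"
      by (auto simp: nbrs_def E_def)
    moreover have "f (u, i) \<in> B" using f(1) ui by auto
    ultimately show "w \<in> (\<lambda>i. f (v, i)) ` {..<d}"
      using that assms(1) by (auto simp: doubleton_eq_iff)
  next
    fix w assume "w \<in> (\<lambda>i. f (v, i)) ` {..<d}"
    then obtain i where i: "i < d" "w = f (v, i)" by auto
    with that have "(v, i) \<in> A \<times> {..<d}" by simp
    then have "{fst (v, i), f (v, i)} \<in> E" unfolding E_def by (rule imageI)
    then show "w \<in> nbrs E v" using i by (simp add: nbrs_def)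
  qed
  then have b: "bij_betw (\<lambda>i. f (v, i)) {..<d} (nbrs E v)" if "v \<in> A" for v
    using f(3) that by (simp add: bij_betw_def)
  have "card (nbrs E v) = d" if "v \<in> A" for v
    using bij_betw_same_card[OF b[OF that]] by simp
  then have "bip_regular_graph A B d E"
    unfolding bip_regular_graph_iff[OF assms(1)] using EB f(2) card_preimage_rows[OF b] by auto
  then show ?thesis using b f(1) by (auto simp: neighbour_orderings_def)
qed

lemma neighbour_orderings_disjoint:
  assumes "A \<inter> B = {}" "bip_regular_graph A B d E" "bip_regular_graph A B d E'"
    and "f \<in> neighbour_orderings A B d E" "f \<in> neighbour_orderings A B d E'"
  shows "E = E'"
proof (rule bip_edges_eqI)
  show "E \<subseteq> bip_edges A B" "E' \<subseteq> bip_edges A B"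
    using assms by (auto simp: bip_regular_graph_iff)
  show "nbrs E v = nbrs E' v" if "v \<in> A" for v
    using assms(4,5) that by (auto simp: neighbour_orderings_def bij_betw_def)
qed

lemma finite_neighbour_orderings:
  "finite A \<Longrightarrow> finite B \<Longrightarrow> finite (neighbour_orderings A B d E)"
  unfolding neighbour_orderings_def
  by (rule finite_subset[of _ "(A \<times> {..<d}) \<rightarrow>\<^sub>E B"]) (auto intro!: finite_PiE)

text \<open>Composing each row with a fixed bijection between the two neighbourhoods of its vertex
  turns numberings for \<open>E\<close> into numberings for \<open>E'\<close>. By symmetry all
  classes have one common size, whose value is never computed.\<close>

lemma card_neighbour_orderings_le:
  assumes "A \<inter> B = {}" "finite A" "finite B" "bip_regular_graph A B d E" "bip_regular_graph A B d E'"
  shows "card (neighbour_orderings A B d E) \<le> card (neighbour_orderings A B d E')"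
proof -
  have sub: "nbrs E v \<subseteq> B" "nbrs E' v \<subseteq> B" if "v \<in> A" for v
    using that assms nbrs_bip_subset[OF _ assms(1) that] by (auto simp: bip_regular_graph_iff)
  have "\<exists>h. bij_betw h (nbrs E v) (nbrs E' v)" if "v \<in> A" for v
  proof (rule finite_same_card_bij)
    show "finite (nbrs E v)" "finite (nbrs E' v)"
      using sub[OF that] assms(3) finite_subset by auto
    show "card (nbrs E v) = card (nbrs E' v)"
      using that assms by (simp add: bip_regular_graph_iff)
  qed
  then obtain h where h: "\<And>v. v \<in> A \<Longrightarrow> bij_betw (h v) (nbrs E v) (nbrs E' v)" by metis
  let ?P = "A \<times> {..<d}"
  let ?m = "\<lambda>f. \<lambda>p\<in>?P. h (fst p) (f p)"
  have fE: "f p \<in> nbrs E (fst p)" if f: "f \<in> neighbour_orderings A B d E" and pP: "p \<in> ?P" for f p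
  proof -
    obtain v i where p: "p = (v, i)" "v \<in> A" "i < d" using pP by auto
    then have "bij_betw (\<lambda>i. f (v, i)) {..<d} (nbrs E v)"
      using f by (auto simp: neighbour_orderings_def)
    then show ?thesis using p by (auto dest: bij_betwE)
  qed
  show ?thesis
  proof (rule card_inj_on_le[where f = ?m])
    show "inj_on ?m (neighbour_orderings A B d E)"
    proof (rule inj_onI)
      fix f g assume f: "f \<in> neighbour_orderings A B d E" and g: "g \<in> neighbour_orderings A B d E"
        and eq: "?m f = ?m g"
      show "f = g"
      proof (rule PiE_ext)
        show "f \<in> ?P \<rightarrow>\<^sub>E B" "g \<in> ?P \<rightarrow>\<^sub>E B" using f g by (auto simp: neighbour_orderings_def)
        fix p assume p: "p \<in> ?P"
        then have "fst p \<in> A" by auto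
        moreover have "h (fst p) (f p) = h (fst p) (g p)" using fun_cong[OF eq, of p] p by simp
        ultimately show "f p = g p"
          using bij_betw_imp_inj_on[OF h] fE[OF f p] fE[OF g p] by (blast dest: inj_onD)
      qed
    qed
    show "?m ` neighbour_orderings A B d E \<subseteq> neighbour_orderings A B d E'"
    proof (rule image_subsetI)
      fix f assume f: "f \<in> neighbour_orderings A B d E"
      have "?m f \<in> ?P \<rightarrow>\<^sub>E B"
      proof (rule PiE_I)
        fix p assume p: "p \<in> ?P"
        then have v: "fst p \<in> A" by auto
        have "h (fst p) (f p) \<in> nbrs E' (fst p)" using bij_betwE[OF h[OF v]] fE[OF f p] by blast
        then show "?m f p \<in> B" using sub(2)[OF v] p by auto
      qed simp
      moreover have "bij_betw (\<lambda>i. ?m f (v, i)) {..<d} (nbrs E' v)" if v: "v \<in> A" for v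
      proof -
        have "bij_betw (\<lambda>i. f (v, i)) {..<d} (nbrs E v)"
          using f v by (auto simp: neighbour_orderings_def)
        then have "bij_betw (h v \<circ> (\<lambda>i. f (v, i))) {..<d} (nbrs E' v)"
          using h[OF v] by (rule bij_betw_trans)
        then show ?thesis by (rule bij_betw_cong[THEN iffD1, rotated]) (simp add: v)
      qed
      ultimately show "?m f \<in> neighbour_orderings A B d E'" by (simp add: neighbour_orderings_def)
    qed
  qed (use assms finite_neighbour_orderings in auto)
qed

text \<open>All classes of orderings have the same size \<open>M\<close>, so graphs are counted by
  assignments up to the factor \<open>M\<close>, which cancels. For graphs with the profile,
  simplicity is dropped and all assignments with the profile are counted. It is paid for once, when
  all assignments are compared with \<open>card G * M\<close>.\<close>

lemma bip_regular_graph_profile: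
  fixes A B Y :: "nat set" and b :: "nat \<Rightarrow> nat" and d :: nat
  assumes AB: "A \<inter> B = {}" and fin: "finite A" "finite B" and card: "card A = card B"
    and d: "d \<ge> 1" and n: "card A \<ge> 4 * d" and Y: "Y \<subseteq> B"
  defines "G \<equiv> {E. bip_regular_graph A B d E}"
  defines "G' \<equiv> {E \<in> G. \<forall>v\<in>A. card (nbrs E v \<inter> Y) = b v}"
  shows "G \<noteq> {}"
    and "card G' * ((card A * d) choose (card Y * d)) \<le> simplicity_constant d * card G * (\<Prod>v\<in>A. d choose b v)"
    and "G' \<noteq> {} \<Longrightarrow> (\<Sum>v\<in>A. b v) = card Y * d"
proof -
  let ?F = "assignments (A \<times> {..<d}) B d"
  let ?O = "neighbour_orderings A B d"
  let ?T = "{f \<in> ?F. \<forall>v\<in>A. card {i \<in> {..<d}. f (v, i) \<in> Y} = b v}"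
  have finG: "finite G" using finite_bip_regular_graphs[OF fin] by (simp add: G_def)
  have finF: "finite ?F" using fin by simp
  have "card ?F > 0" using assignments_nonempty[OF fin card] finF by (simp add: card_gt_0_iff)
  then have "simple_assignments A B d \<noteq> {}"
    using card_assignments_le_simple[OF fin d n] by (metis card.empty mult_0_right not_less)
  then obtain f0 where "f0 \<in> simple_assignments A B d" by blast
  then obtain E0 where E0: "E0 \<in> G" "f0 \<in> ?O E0"
    using simple_neighbour_orderings[OF AB] by (auto simp: G_def)
  then show "G \<noteq> {}" by auto
  define M where "M = card (?O E0)"
  have M: "M > 0" using E0 finite_neighbour_orderings[OF fin] by (auto simp: M_def card_gt_0_iff)
  have cM: "card (?O E) = M" if "E \<in> G" for E
    using that E0 unfolding M_def G_def
    by (intro antisym card_neighbour_orderings_le AB fin) auto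
  have cU: "card (\<Union>E\<in>H. ?O E) = card H * M" if "H \<subseteq> G" for H
  proof -
    have "?O E \<inter> ?O E' = {}" if "E \<in> H" "E' \<in> H" "E \<noteq> E'" for E E'
      using that \<open>H \<subseteq> G\<close> neighbour_orderings_disjoint[OF AB] unfolding G_def by blast
    then have "card (\<Union>E\<in>H. ?O E) = (\<Sum>E\<in>H. card (?O E))"
      using that finite_subset[OF that finG] finite_neighbour_orderings[OF fin]
      by (intro card_UN_disjoint) auto
    also have "\<dots> = (\<Sum>E\<in>H. M)" using that cM by (intro sum.cong) auto
    finally show ?thesis by simp
  qed
  have "simple_assignments A B d \<subseteq> (\<Union>E\<in>G. ?O E)"
    using simple_neighbour_orderings[OF AB] by (fastforce simp: G_def)
  then have "card (simple_assignments A B d) \<le> card G * M"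
    using finG finite_neighbour_orderings[OF fin] unfolding cU[OF order_refl, symmetric]
    by (intro card_mono) auto
  then have F: "card ?F \<le> simplicity_constant d * (card G * M)"
    using card_assignments_le_simple[OF fin d n] by (meson mult_le_mono2 order_trans)
  have sub: "(\<Union>E\<in>G'. ?O E) \<subseteq> ?T"
  proof clarify
    fix E f assume E: "E \<in> G'" and f: "f \<in> ?O E"
    have "f \<in> simple_assignments A B d"
      using E f by (intro neighbour_orderings_simple[OF AB]) (auto simp: G'_def G_def)
    moreover have "card {i \<in> {..<d}. f (v, i) \<in> Y} = b v" if v: "v \<in> A" for v
    proof -
      have bij: "bij_betw (\<lambda>i. f (v, i)) {..<d} (nbrs E v)"
        using f v by (auto simp: neighbour_orderings_def)
      have "bij_betw (\<lambda>i. f (v, i)) {i \<in> {..<d}. f (v, i) \<in> Y} (nbrs E v \<inter> Y)"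
        using bij by (auto simp: bij_betw_def inj_on_def)
      then have "card {i \<in> {..<d}. f (v, i) \<in> Y} = card (nbrs E v \<inter> Y)"
        by (rule bij_betw_same_card)
      then show ?thesis using E v by (simp add: G'_def)
    qed
    ultimately show "f \<in> ?F \<and> (\<forall>v\<in>A. card {i \<in> {..<d}. f (v, i) \<in> Y} = b v)"
      by (simp add: simple_assignments_def)
  qed
  then have "card (\<Union>E\<in>G'. ?O E) \<le> card ?T" using finF by (intro card_mono) auto
  then have T: "card G' * M \<le> card ?T" using cU[of G'] by (simp add: G'_def)
  let ?C = "(card A * d) choose (card Y * d)"
  let ?\<Pi> = "\<Prod>v\<in>A. d choose b v"
  have "M * (card G' * ?C) = (card G' * M) * ?C" by (simp only: mult_ac)
  also have "\<dots> \<le> card ?T * ?C" using T by (rule mult_le_mono1)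
  also have "\<dots> \<le> card ?F * ?\<Pi>" by (rule card_assignments_profile(1)[OF fin Y])
  also have "\<dots> \<le> (simplicity_constant d * (card G * M)) * ?\<Pi>" using F by (rule mult_le_mono1)
  also have "\<dots> = M * (simplicity_constant d * card G * ?\<Pi>)" by (simp only: mult_ac)
  finally show "card G' * ?C \<le> simplicity_constant d * card G * ?\<Pi>" using M by simp
  assume "G' \<noteq> {}"
  then obtain E where E: "E \<in> G'" by auto
  then have "E \<in> G" by (simp add: G'_def)
  then have "?O E \<noteq> {}" using cM[of E] M by auto
  then have "?T \<noteq> {}" using sub E by blast
  then show "(\<Sum>v\<in>A. b v) = card Y * d" by (rule card_assignments_profile(2)[OF fin Y])
qed

subsection \<open>Valid partitions\<close>

lemma bip_edges_commute: "bip_edges A B = bip_edges B A"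
  unfolding bip_edges_def by (rule Collect_cong) (metis insert_commute)

lemma valid_partition_complement:
  assumes "valid_partition n d1 d2 E V"
  shows "valid_partition n d1 d2 E (vertices n - V)"
proof -
  have V: "V \<subseteq> vertices n" "card V = n" using assms by (auto simp: valid_partition_def)
  have "vertices n - (vertices n - V) = V" using V by blast
  moreover have "card (vertices n - V) = n"
    using V by (subst card_Diff_subset) (auto simp: vertices_def intro: finite_subset)
  moreover have "between E (vertices n - V) V = between E V (vertices n - V)"
    by (auto simp: between_def)
  moreover have "bip_regular_graph W V d X" if "bip_regular_graph V W d X" for V W d X
    using that bip_edges_commute[of V W] unfolding bip_regular_graph_def bip_edges_def
    by (simp add: Un_commute)
  ultimately show ?thesis using assms by (auto simp: valid_partition_def)
qed

text \<open>The degree that the partition prescribes, less what \<open>E1\<close> already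
  contributes. Truncated subtraction does no harm: agreement with a graph is claimed for valid
  partitions only, and the probability bound holds for every profile.\<close>

definition forced_profile :: "nat \<Rightarrow> nat \<Rightarrow> nat set set \<Rightarrow> nat set \<Rightarrow> nat \<Rightarrow> nat" where
  "forced_profile d1 d2 E X v =
     (if v \<in> X then d1 - card {e \<in> E. v \<in> e \<and> e \<subseteq> X} else d2 - card {e \<in> E. v \<in> e \<and> e \<inter> X \<noteq> {}})"

text \<open>Membership of a vertex of \<open>A\<close> in \<open>V\<close> decides which of the two degree conditions applies to it,
  and that condition fixes its number of \<open>E3\<close>-neighbours in \<open>V\<close>.\<close>

lemma valid_partition_profile:
  assumes AB: "A \<union> B = vertices n" "A \<inter> B = {}"
    and E: "\<And>e. e \<in> E1 \<Longrightarrow> e \<subseteq> A" "\<And>e. e \<in> E2 \<Longrightarrow> e \<subseteq> B" "E3 \<subseteq> bip_edges A B"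
    and V: "valid_partition n d1 d2 (E1 \<union> E2 \<union> E3) V" and v: "v \<in> A"
  shows "card (nbrs E3 v \<inter> (V \<inter> B)) = forced_profile d1 d2 E1 (V \<inter> A) v"
proof -
  let ?E = "E1 \<union> E2 \<union> E3"
  have finV: "finite (A \<union> B)" unfolding AB by (simp add: vertices_def)
  have "bip_edges A B \<subseteq> Pow (A \<union> B)" by (auto simp: bip_edges_def)
  then have "E1 \<subseteq> Pow (A \<union> B)" "E3 \<subseteq> Pow (A \<union> B)" using E by blast+
  then have finE: "finite E1" "finite E3" using finV by (meson finite_Pow_iff finite_subset)+
  have VV: "V \<subseteq> A \<union> B" using V AB by (simp add: valid_partition_def)
  have nb: "nbrs E3 v \<subseteq> B" using nbrs_bip_subset[OF E(3) AB(2) v] .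
  \<comment> \<open>No edge of \<open>E2\<close> meets \<open>v\<close>. The predicate
    \<open>Q\<close> becomes containment in \<open>V\<close> if \<open>v\<close> lies in
    \<open>V\<close>, and meeting \<open>V\<close> otherwise.\<close>
  have split: "card {e \<in> ?E. v \<in> e \<and> Q e} = card {e \<in> E1. v \<in> e \<and> Q e} + card {w \<in> nbrs E3 v. Q {v, w}}" for Q
  proof -
    have "{e \<in> ?E. v \<in> e \<and> Q e} = {e \<in> E1. v \<in> e \<and> Q e} \<union> {e \<in> E3. v \<in> e \<and> Q e}"
      using E(2) v AB(2) by blast
    moreover have "{e \<in> E1. v \<in> e \<and> Q e} \<inter> {e \<in> E3. v \<in> e \<and> Q e} = {}"
      using E(1,3) AB(2) by (fastforce simp: bip_edges_def)
    ultimately show ?thesis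
      using finE card_edges_at[OF E(3) AB(2) v, of Q] by (simp add: card_Un_disjoint)
  qed
  show ?thesis
  proof (cases "v \<in> V")
    case True
    have "d1 = degree_in (induced ?E V) v"
      using V True by (auto simp: valid_partition_def regular_graph_def)
    also have "\<dots> = card {e \<in> ?E. v \<in> e \<and> e \<subseteq> V}"
      unfolding degree_in_def induced_def by (rule arg_cong[where f = card]) auto
    also have "\<dots> = card {e \<in> E1. v \<in> e \<and> e \<subseteq> V} + card {w \<in> nbrs E3 v. {v, w} \<subseteq> V}"
      by (rule split)
    also have "{w \<in> nbrs E3 v. {v, w} \<subseteq> V} = nbrs E3 v \<inter> (V \<inter> B)" using nb True by auto
    also have "{e \<in> E1. v \<in> e \<and> e \<subseteq> V} = {e \<in> E1. v \<in> e \<and> e \<subseteq> V \<inter> A}" using E(1) by auto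
    finally show ?thesis using True v by (simp add: forced_profile_def)
  next
    case False
    then have vW: "v \<in> vertices n - V" using v AB by auto
    have "d2 = degree_in (between ?E V (vertices n - V)) v"
      using V vW by (auto simp: valid_partition_def bip_regular_graph_def)
    also have "\<dots> = card {e \<in> ?E. v \<in> e \<and> e \<inter> V \<noteq> {}}"
      unfolding degree_in_def between_def using vW by (intro arg_cong[where f = card]) auto
    also have "\<dots> = card {e \<in> E1. v \<in> e \<and> e \<inter> V \<noteq> {}} + card {w \<in> nbrs E3 v. {v, w} \<inter> V \<noteq> {}}"
      by (rule split)
    also have "{w \<in> nbrs E3 v. {v, w} \<inter> V \<noteq> {}} = nbrs E3 v \<inter> (V \<inter> B)" using nb False by auto
    also have "{e \<in> E1. v \<in> e \<and> e \<inter> V \<noteq> {}} = {e \<in> E1. v \<in> e \<and> e \<inter> (V \<inter> A) \<noteq> {}}" using E(1) by auto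
    finally show ?thesis using False v by (simp add: forced_profile_def)
  qed
qed

lemma not_unique_partition_profile:
  assumes AB: "A \<union> B = vertices n" "A \<inter> B = {}" "card A = n" "card B = n"
    and E: "\<And>e. e \<in> E1 \<Longrightarrow> e \<subseteq> A" "\<And>e. e \<in> E2 \<Longrightarrow> e \<subseteq> B" "E3 \<subseteq> bip_edges A B"
    and nu: "\<not> unique_partition n d1 d2 A (E1 \<union> E2 \<union> E3)"
  shows "\<exists>k X Y. 1 \<le> k \<and> 2 * k \<le> n \<and> X \<subseteq> A \<and> card X = n - k \<and> Y \<subseteq> B \<and> card Y = k \<and>
    (\<forall>v\<in>A. card (nbrs E3 v \<inter> Y) = forced_profile d1 d2 E1 X v)"
proof -
  let ?E = "E1 \<union> E2 \<union> E3"
  have fin: "finite A" "finite B" using AB(1) by (auto simp: vertices_def intro: finite_subset)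
  have B: "B = vertices n - A" using AB by auto
  obtain V where V: "valid_partition n d1 d2 ?E V" "V \<noteq> A" "V \<noteq> B"
    using nu B by (auto simp: unique_partition_def)
  have ex: "\<exists>V. valid_partition n d1 d2 ?E V \<and> V \<noteq> A \<and> 2 * card (V \<inter> B) \<le> n"
  proof (cases "2 * card (V \<inter> B) \<le> n")
    case False
    have "(vertices n - V) \<inter> B = B - V \<inter> B" using B by auto
    then have "card ((vertices n - V) \<inter> B) = n - card (V \<inter> B)"
      using fin AB(4) by (simp add: card_Diff_subset)
    \<comment> \<open>This uses \<open>V \<noteq> B\<close>: the complement of \<open>V\<close> must
      not be the true part \<open>A\<close>.\<close>
    moreover have "vertices n - V \<noteq> A"
      using V B by (auto simp: valid_partition_def)
    ultimately show ?thesis using False valid_partition_complement[OF V(1)] by (intro exI[of _ "vertices n - V"]) auto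
  qed (use V in auto)
  then obtain V where V: "valid_partition n d1 d2 ?E V" "V \<noteq> A" "2 * card (V \<inter> B) \<le> n" by blast
  have VV: "V \<subseteq> A \<union> B" "card V = n" using V(1) AB by (auto simp: valid_partition_def)
  have "V = (V \<inter> A) \<union> (V \<inter> B)" using VV by auto
  then have "card V = card (V \<inter> A) + card (V \<inter> B)"
    using fin AB(2) by (metis card_Un_disjoint finite_Int inf.commute inf_bot_right inf_left_commute)
  then have c: "card (V \<inter> A) = n - card (V \<inter> B)" using VV by simp
  have "card (V \<inter> B) \<noteq> 0"
  proof
    assume "card (V \<inter> B) = 0"
    then have "V \<subseteq> A" using fin VV by auto
    then show False using V(2) VV(2) AB(3) fin by (simp add: card_subset_eq)
  qed
  then show ?thesis
    using V(3) c valid_partition_profile[OF AB(1,2) E V(1)]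
    by (intro exI[of _ "card (V \<inter> B)"] exI[of _ "V \<inter> A"] exI[of _ "V \<inter> B"]) auto
qed

section \<open>Existence of regular graphs by the circulant construction\<close>

lemma symmetric_residues_exist:
  assumes "d < n" "even (n * d)"
  shows "\<exists>C. C \<subseteq> {1..<n} \<and> card C = d \<and> (\<forall>c\<in>C. n - c \<in> C)"
proof -
  define h where "h = d div 2"
  define C where "C = {1..h} \<union> {n - h..<n}"
  have h: "2 * h < n" using assms by (simp add: h_def)
  have c: "card C = 2 * h"
    unfolding C_def using h by (subst card_Un_disjoint) auto
  have sym: "\<forall>c\<in>C. n - c \<in> C" and sub: "C \<subseteq> {1..<n}" using h by (auto simp: C_def)
  show ?thesis
  proof (cases "even d")
    case True
    then show ?thesis using c sym sub by (intro exI[of _ C]) (auto simp: h_def)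
  next
    \<comment> \<open>An odd \<open>d\<close> forces \<open>n\<close> to be even, and
      \<open>n / 2\<close>, its own negative modulo \<open>n\<close>, supplies the odd
      element.\<close>
    case False
    then have d: "d = 2 * h + 1" by (simp add: h_def)
    then have "even n" using assms(2) False by simp
    then obtain m where m: "n = 2 * m" by (elim evenE)
    have "m \<notin> C" using h m assms d by (auto simp: C_def)
    then have "card (insert m C) = d" using c d by (simp add: C_def)
    then show ?thesis using sym sub m assms by (intro exI[of _ "insert m C"]) auto
  qed
qed

text \<open>The circulant graph with connection set \<open>C\<close> on the residues modulo
  \<open>n\<close>, transported to \<open>A\<close>. Existence matters because
  \<open>pmf_of_set\<close> has the intended support only for a nonempty set: it ensures that the
  graphs drawn inside \<open>A\<close> and \<open>B\<close> are regular at all.\<close>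

lemma regular_graph_exists:
  assumes "finite A" "card A = n" "d < n" "even (n * d)"
  shows "\<exists>E. regular_graph A d E"
proof -
  obtain C where C: "C \<subseteq> {1..<n}" "card C = d" "\<And>c. c \<in> C \<Longrightarrow> n - c \<in> C"
    using symmetric_residues_exist[OF assms(3,4)] by auto
  obtain h where h: "bij_betw h {..<n} A"
    using assms(1,2) ex_bij_betw_nat_finite[of A] by (auto simp: atLeast0LessThan)
  have inj: "h i = h j \<longleftrightarrow> i = j" if "i < n" "j < n" for i j
    using bij_betw_imp_inj_on[OF h] that by (auto dest: inj_onD)
  define E where "E = {{h i, h ((i + c) mod n)} | i c. i < n \<and> c \<in> C}"
  have ne: "(i + c) mod n \<noteq> i" if "i < n" "c \<in> C" for i c
  proof -
    have "0 < c" "c < n" using C(1) that by auto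
    then show ?thesis using that by (cases "i + c < n") (auto simp: mod_if)
  qed
  have cinj: "c = c'" if "(i + c) mod n = (i + c') mod n" "i < n" "c \<in> C" "c' \<in> C" for i c c'
  proof -
    have "c < n" "c' < n" using C(1) that by auto
    then show ?thesis using that(1,2) by (auto simp: mod_if split: if_splits)
  qed
  have "degree_in E w = d" if w: "w \<in> A" for w
  proof -
    obtain i where i: "i < n" "w = h i" using w bij_betw_imp_surj_on[OF h] by auto
    have "{e \<in> E. w \<in> e} = (\<lambda>c. {h i, h ((i + c) mod n)}) ` C"
    proof (intro equalityI subsetI)
      fix e assume "e \<in> {e \<in> E. w \<in> e}"
      then obtain j c where e: "e = {h j, h ((j + c) mod n)}" "j < n" "c \<in> C" "w \<in> e"
        by (auto simp: E_def)
      then consider "j = i" | "i = (j + c) mod n" using i inj by auto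
      then show "e \<in> (\<lambda>c. {h i, h ((i + c) mod n)}) ` C"
      proof cases
        \<comment> \<open>An edge generated from its other end \<open>j\<close> is also generated
          from \<open>i\<close>, with \<open>n - c\<close> in the role of \<open>-c\<close>.\<close>
        case 2
        have "c < n" using C(1) e by auto
        then have "(i + (n - c)) mod n = (j + c + (n - c)) mod n" by (simp only: 2 mod_add_left_eq)
        then have "(i + (n - c)) mod n = j" using e \<open>c < n\<close> by simp
        then show ?thesis using e 2 C(3) by (auto simp: insert_commute intro!: image_eqI[of _ _ "n - c"])
      qed (use e in auto)
    qed (use i in \<open>auto simp: E_def\<close>)
    moreover have "inj_on (\<lambda>c. {h i, h ((i + c) mod n)}) C"
    proof (rule inj_onI)
      fix c c' assume cc: "c \<in> C" "c' \<in> C" "{h i, h ((i + c) mod n)} = {h i, h ((i + c') mod n)}"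
      then have "h ((i + c) mod n) = h ((i + c') mod n)" by (auto simp: doubleton_eq_iff)
      then have "(i + c) mod n = (i + c') mod n" using inj i by auto
      then show "c = c'" using cinj cc i by blast
    qed
    ultimately show ?thesis using C(2) by (simp add: degree_in_def card_image)
  qed
  moreover have "E \<subseteq> {e. e \<subseteq> A \<and> card e = 2}"
  proof
    fix e assume "e \<in> E"
    then obtain i c where e: "e = {h i, h ((i + c) mod n)}" "i < n" "c \<in> C" by (auto simp: E_def)
    moreover have "h i \<noteq> h ((i + c) mod n)" using e ne inj by (metis mod_less_divisor not_less0 neq0_conv)
    moreover have "h i \<in> A" "h ((i + c) mod n) \<in> A" using e bij_betwE[OF h] by auto
    ultimately show "e \<in> {e. e \<subseteq> A \<and> card e = 2}" by simp
  qed
  ultimately show ?thesis by (auto simp: regular_graph_def)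
qed

subsection \<open>The probability estimate\<close>

text \<open>A lower bound valid for every outcome of the first draw survives averaging. Three
  applications freeze \<open>A\<close>, \<open>E1\<close> and \<open>E2\<close> and leave only the
  draw of the bipartite graph.\<close>

lemma prob_bind_pmf_ge:
  assumes "\<And>x. x \<in> set_pmf p \<Longrightarrow> c \<le> measure_pmf.prob (f x) S"
  shows "c \<le> measure_pmf.prob (bind_pmf p f) S"
proof (cases "c \<ge> 0")
  case True
  have "ennreal c = (\<integral>\<^sup>+x. ennreal c \<partial>measure_pmf p)" by simp
  also have "\<dots> \<le> (\<integral>\<^sup>+x. emeasure (measure_pmf (f x)) S \<partial>measure_pmf p)"
    using assms by (intro nn_integral_mono_AE AE_pmfI) (simp add: measure_pmf.emeasure_eq_measure)
  also have "\<dots> = ennreal (measure_pmf.prob (bind_pmf p f) S)"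
    by (simp flip: measure_pmf.emeasure_eq_measure)
  finally show ?thesis by simp
next
  case False
  then show ?thesis using measure_nonneg[of "measure_pmf (bind_pmf p f)" S] by linarith
qed

lemma card_not_unique_le:
  fixes A B :: "nat set" and d1 d2 n :: nat
  assumes AB: "A \<union> B = vertices n" "A \<inter> B = {}" "card A = n" "card B = n"
    and d: "d2 \<ge> 1000" and n: "n \<ge> 4 * d2"
    and E: "\<And>e. e \<in> E1 \<Longrightarrow> e \<subseteq> A" "\<And>e. e \<in> E2 \<Longrightarrow> e \<subseteq> B"
  defines "G \<equiv> {E. bip_regular_graph A B d2 E}"
  shows "card {E3 \<in> G. \<not> unique_partition n d1 d2 A (E1 \<union> E2 \<union> E3)}
    \<le> simplicity_constant d2 * union_bound d2 n * card G"
proof -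
  have fin: "finite A" "finite B" using AB(1) by (auto simp: vertices_def intro: finite_subset)
  have finG: "finite G" unfolding G_def by (rule finite_bip_regular_graphs[OF fin])
  let ?K = "real (simplicity_constant d2)"
  have "simplicity_constant d2 > 0" by (simp add: simplicity_constant_def)
  then have K: "?K > 0" by simp
  define R where "R X Y = {E3 \<in> G. \<forall>v\<in>A. card (nbrs E3 v \<inter> Y) = forced_profile d1 d2 E1 X v}" for X Y
  define S where "S k = {X. X \<subseteq> A \<and> card X = n - k} \<times> {Y. Y \<subseteq> B \<and> card Y = k}" for k
  have cS: "finite (S k)" "k \<le> n \<Longrightarrow> card (S k) = (n choose k)\<^sup>2" for k
    using fin AB by (auto simp: S_def card_cartesian_product n_subsets power2_eq_square binomial_symmetric[symmetric])
  \<comment> \<open>The factor \<open>(n choose k)^2\<close> is the number of pairs in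
    \<open>S k\<close>. With it the bound is the same for all pairs of one \<open>k\<close>, and the
    sum over \<open>S k\<close> collapses after dividing by it.\<close>
  have R: "card (R X Y) * (real (n choose k))\<^sup>2 \<le> ?K * card G * union_term d2 n k"
    if k: "1 \<le> k" "2 * k \<le> n" and XY: "(X, Y) \<in> S k" for k X Y
  proof -
    let ?b = "forced_profile d1 d2 E1 X"
    let ?r = "(\<Prod>v\<in>A. d2 choose ?b v) / ((n * d2) choose (k * d2))"
    have Y: "Y \<subseteq> B" "card Y = k" using XY by (auto simp: S_def)
    have A: "card A = card B" "d2 \<ge> 1" "card A \<ge> 4 * d2" using AB d n by auto
    note prof = bip_regular_graph_profile(2,3)[OF AB(2) fin A Y(1), of ?b,
        folded G_def, folded R_def, unfolded AB(3) Y(2)]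
    show ?thesis
    \<comment> \<open>The ratio estimates need a profile with sum \<open>k * d\<close>, which is
      known only if some graph realises it.\<close>
    proof (cases "R X Y = {}")
      case True
      have "union_term d2 n k \<ge> 0" by (simp add: union_term_def)
      then show ?thesis using True K by simp
    next
      case False
      have b: "(\<Sum>v\<in>A. ?b v) = k * d2" by (rule prof(2)[OF False])
      have C: "((n * d2) choose (k * d2)) > 0" using k by simp
      have "?r \<ge> 0" by (simp add: prod_nonneg)
      have "(real (n choose k))\<^sup>2 * ?r \<le> union_term d2 n k"
        using profile_ratio_small[OF fin(1) AB(3) b] profile_ratio_large[OF fin(1) AB(3) b] k d
        by (intro union_term_ge \<open>?r \<ge> 0\<close>) auto
      moreover have "real (card (R X Y)) \<le> ?K * card G * ?r"
      proof -
        have "real (card (R X Y) * ((n * d2) choose (k * d2)))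
            \<le> real (simplicity_constant d2 * card G * (\<Prod>v\<in>A. d2 choose ?b v))"
          using prof(1) by (simp only: of_nat_le_iff)
        then show ?thesis using C by (simp add: field_simps)
      qed
      ultimately have "real (card (R X Y)) * (real (n choose k))\<^sup>2
          \<le> (?K * card G * ?r) * (real (n choose k))\<^sup>2"
        by (intro mult_right_mono) auto
      also have "\<dots> = ?K * card G * ((real (n choose k))\<^sup>2 * ?r)" by (simp only: mult_ac)
      also have "\<dots> \<le> ?K * card G * union_term d2 n k"
        using \<open>(real (n choose k))\<^sup>2 * ?r \<le> union_term d2 n k\<close> K by (intro mult_left_mono) auto
      finally show ?thesis .
    qed
  qed
  have "{E3 \<in> G. \<not> unique_partition n d1 d2 A (E1 \<union> E2 \<union> E3)}
      \<subseteq> (\<Union>k\<in>{1..n div 2}. \<Union>(X, Y)\<in>S k. R X Y)"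
  proof clarify
    fix E3 assume G: "E3 \<in> G" and nu: "\<not> unique_partition n d1 d2 A (E1 \<union> E2 \<union> E3)"
    have "E3 \<subseteq> bip_edges A B" using G by (simp add: G_def bip_regular_graph_iff[OF AB(2)])
    from not_unique_partition_profile[OF AB E this nu] obtain k X Y where
      "1 \<le> k" "2 * k \<le> n" "X \<subseteq> A" "card X = n - k" "Y \<subseteq> B" "card Y = k"
      "\<forall>v\<in>A. card (nbrs E3 v \<inter> Y) = forced_profile d1 d2 E1 X v" by blast
    then have "k \<in> {1..n div 2}" "(X, Y) \<in> S k" "E3 \<in> R X Y"
      using G by (auto simp: S_def R_def)
    then show "E3 \<in> (\<Union>k\<in>{1..n div 2}. \<Union>(X, Y)\<in>S k. R X Y)" by blast
  qed
  then have "card {E3 \<in> G. \<not> unique_partition n d1 d2 A (E1 \<union> E2 \<union> E3)}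
      \<le> card (\<Union>k\<in>{1..n div 2}. \<Union>(X, Y)\<in>S k. R X Y)"
    using cS finG by (intro card_mono) (auto simp: R_def)
  also have "\<dots> \<le> (\<Sum>k\<in>{1..n div 2}. card (\<Union>(X, Y)\<in>S k. R X Y))"
    by (intro card_UN_le) auto
  also have "\<dots> \<le> (\<Sum>k\<in>{1..n div 2}. \<Sum>(X, Y)\<in>S k. card (R X Y))"
    using cS card_UN_le[of "S k" "\<lambda>(X, Y). R X Y" for k]
    by (intro sum_mono) (simp add: case_prod_beta)
  finally have "real (card {E3 \<in> G. \<not> unique_partition n d1 d2 A (E1 \<union> E2 \<union> E3)})
      \<le> real (\<Sum>k\<in>{1..n div 2}. \<Sum>(X, Y)\<in>S k. card (R X Y))"
    by (simp only: of_nat_le_iff)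
  also have "\<dots> = (\<Sum>k\<in>{1..n div 2}. \<Sum>(X, Y)\<in>S k. real (card (R X Y)))"
    by (simp add: case_prod_beta)
  also have "\<dots> \<le> (\<Sum>k\<in>{1..n div 2}. ?K * card G * union_term d2 n k)"
  proof (rule sum_mono)
    fix k assume "k \<in> {1..n div 2}"
    then have k: "1 \<le> k" "2 * k \<le> n" by auto
    have C: "(real (n choose k))\<^sup>2 > 0" using k by simp
    have "(\<Sum>(X, Y)\<in>S k. real (card (R X Y)))
       \<le> (\<Sum>(X, Y)\<in>S k. ?K * card G * union_term d2 n k / (real (n choose k))\<^sup>2)"
      using R[OF k] C by (intro sum_mono) (auto simp: pos_le_divide_eq)
    also have "\<dots> = ?K * card G * union_term d2 n k"
      using cS(2)[of k] k C by (simp add: case_prod_beta)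
    finally show "(\<Sum>(X, Y)\<in>S k. real (card (R X Y))) \<le> ?K * card G * union_term d2 n k" .
  qed
  also have "\<dots> = ?K * card G * (\<Sum>k\<in>{1..n div 2}. union_term d2 n k)"
    by (simp add: sum_distrib_left)
  also have "\<dots> \<le> ?K * card G * union_bound d2 n"
    using sum_union_term_le K by (intro mult_left_mono) auto
  finally show ?thesis by (simp add: mult_ac)
qed

lemma finite_regular_graphs: "finite A \<Longrightarrow> finite {E. regular_graph A d E}"
  by (rule finite_subset[of _ "Pow (Pow A)"]) (auto simp: regular_graph_def)

lemma prob_unique_partition_ge:
  assumes d: "d2 \<ge> 1000" and n: "n \<ge> 4 * d2" "n > d1" and ev: "even (n * d1)"
  shows "1 - simplicity_constant d2 * union_bound d2 n
    \<le> measure_pmf.prob (sbm n d1 d2) {(A, E). unique_partition n d1 d2 A E}"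
  unfolding sbm_def Let_def
proof (rule prob_bind_pmf_ge, rule prob_bind_pmf_ge, rule prob_bind_pmf_ge)
  let ?U = "{(A, E). unique_partition n d1 d2 A E}"
  fix A E1 E2
  assume A: "A \<in> set_pmf (pmf_of_set {A. A \<subseteq> vertices n \<and> card A = n})"
    and E1: "E1 \<in> set_pmf (pmf_of_set {E. regular_graph A d1 E})"
    and E2: "E2 \<in> set_pmf (pmf_of_set {E. regular_graph (vertices n - A) d1 E})"
  define B where "B = vertices n - A"
  have "finite (vertices n)" "card (vertices n) = 2 * n" by (auto simp: vertices_def)
  moreover have "{A. A \<subseteq> vertices n \<and> card A = n} \<noteq> {}"
    by (auto simp: vertices_def intro!: exI[of _ "{..<n}"])
  ultimately have "A \<subseteq> vertices n" "card A = n"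
    using A by (auto simp: set_pmf_of_set)
  then have AB: "A \<union> B = vertices n" "A \<inter> B = {}" "card A = n" "card B = n" "finite A" "finite B"
    using \<open>finite (vertices n)\<close> \<open>card (vertices n) = 2 * n\<close> finite_subset[of A "vertices n"]
    by (auto simp: B_def card_Diff_subset)
  have "regular_graph A d1 E1" "regular_graph B d1 E2"
    using E1 E2 regular_graph_exists[OF _ _ n(2) ev] finite_regular_graphs AB
    by (auto simp: set_pmf_of_set simp flip: B_def)
  then have E: "e \<in> E1 \<Longrightarrow> e \<subseteq> A" "e \<in> E2 \<Longrightarrow> e \<subseteq> B" for e
    by (auto simp: regular_graph_def)
  let ?G = "{E. bip_regular_graph A B d2 E}"
  let ?bad = "{E3 \<in> ?G. \<not> unique_partition n d1 d2 A (E1 \<union> E2 \<union> E3)}"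
  \<comment> \<open>The profile lemma is instantiated at the empty set merely for its existence
    claim.\<close>
  have G: "?G \<noteq> {}" "finite ?G"
    using bip_regular_graph_profile(1)[OF AB(2,5,6), of d2 "{}"] finite_bip_regular_graphs[OF AB(5,6)] AB d n by auto
  have "?G \<inter> {E3. (A, E1 \<union> E2 \<union> E3) \<in> ?U} = ?G - ?bad" by auto
  moreover have "card (?G - ?bad) = card ?G - card ?bad"
    by (rule card_Diff_subset) (use G in auto)
  ultimately have "card (?G \<inter> {E3. (A, E1 \<union> E2 \<union> E3) \<in> ?U}) = card ?G - card ?bad"
    by (simp only:)
  moreover have "card ?bad \<le> card ?G" using G by (intro card_mono) auto
  ultimately have "real (card (?G \<inter> {E3. (A, E1 \<union> E2 \<union> E3) \<in> ?U})) = real (card ?G) - real (card ?bad)"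
    by (simp add: of_nat_diff)
  also have "\<dots> \<ge> card ?G * (1 - simplicity_constant d2 * union_bound d2 n)"
    using card_not_unique_le[OF AB(1-4) d n(1) E, where ?d1.0 = d1] by (simp add: algebra_simps)
  finally have "1 - simplicity_constant d2 * union_bound d2 n
      \<le> card (?G \<inter> {E3. (A, E1 \<union> E2 \<union> E3) \<in> ?U}) / card ?G"
    using G by (simp add: pos_le_divide_eq card_gt_0_iff mult.commute)
  also have "\<dots> = measure_pmf.prob (pmf_of_set ?G) {E3. (A, E1 \<union> E2 \<union> E3) \<in> ?U}"
    using G by (simp add: measure_pmf_of_set)
  also have "\<dots> = measure_pmf.prob (map_pmf (\<lambda>E3. (A, E1 \<union> E2 \<union> E3)) (pmf_of_set ?G)) ?U"
    by (simp add: vimage_def)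
  finally show "1 - simplicity_constant d2 * union_bound d2 n
      \<le> measure_pmf.prob (bind_pmf (pmf_of_set {E. bip_regular_graph A (vertices n - A) d2 E})
          (\<lambda>E3. return_pmf (A, E1 \<union> E2 \<union> E3))) ?U"
    by (simp add: map_pmf_def B_def)
qed

theorem theorem1p3:
  shows "\<exists>d'::real. d' > 0 \<and>
    (\<forall>d1 d2 :: nat. d1 > d2 \<and> real d2 > d' \<longrightarrow>
      (\<forall>\<epsilon>>0. \<exists>N. \<forall>n\<ge>N. even (n * d1) \<longrightarrow>
         measure_pmf.prob (sbm n d1 d2)
           {(A, E). unique_partition n d1 d2 A E} \<ge> 1 - \<epsilon>))"
\<comment> \<open>The constant is dictated by \<open>union_term_large\<close>;
  \<open>union_term_small\<close> asks only for 60.\<close>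
proof (intro exI[of _ "1000::real"] conjI allI impI)
  fix d1 d2 :: nat and \<epsilon> :: real
  assume d: "d2 < d1 \<and> 1000 < real d2" and \<epsilon>: "0 < \<epsilon>"
  have "(\<lambda>n. simplicity_constant d2 * union_bound d2 n) \<longlonglongrightarrow> real (simplicity_constant d2) * 0"
    by (intro tendsto_intros union_bound_tendsto_0)
  then have "\<forall>\<^sub>F n in sequentially. simplicity_constant d2 * union_bound d2 n < \<epsilon>"
    using \<epsilon> by (intro order_tendstoD) auto
  then obtain N where N: "\<And>n. n \<ge> N \<Longrightarrow> simplicity_constant d2 * union_bound d2 n < \<epsilon>"
    by (auto simp: eventually_sequentially)
  show "\<exists>N. \<forall>n\<ge>N. even (n * d1) \<longrightarrow>
    1 - \<epsilon> \<le> measure_pmf.prob (sbm n d1 d2) {(A, E). unique_partition n d1 d2 A E}"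
  \<comment> \<open>The bound \<open>4 * d2\<close> leaves room for the switchings, and
    \<open>Suc d1\<close> makes \<open>d1\<close>-regular graphs on \<open>n\<close> vertices
    possible.\<close>
  proof (intro exI[of _ "max N (max (4 * d2) (Suc d1))"] allI impI)
    fix n assume n: "max N (max (4 * d2) (Suc d1)) \<le> n" "even (n * d1)"
    then have "1 - simplicity_constant d2 * union_bound d2 n
        \<le> measure_pmf.prob (sbm n d1 d2) {(A, E). unique_partition n d1 d2 A E}"
      using d by (intro prob_unique_partition_ge) auto
    then show "1 - \<epsilon> \<le> measure_pmf.prob (sbm n d1 d2) {(A, E). unique_partition n d1 d2 A E}"
      using N[of n] n by linarith
  qed
qed simp

end
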